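(* Let $c_0>0$, and for $\alpha\in[0,1]$ let $\vec A^+_{c_0,\alpha}\in\mathbb S^2$ be the limiting vector defined in the context. Then $\vec A^+_{c_0,\alpha}$ is a continuous function of $\alpha$ in $[0,1]$, and the following inequalities hold true: $$|\vec A^+_{c_0,\alpha}-\vec A^+_{c_0,0}|\le C(c_0)\sqrt{\alpha}\,|\ln(\alpha)|,\quad\text{for all }\alpha\in(0,1/2],$$ $$|\vec A^+_{c_0,\alpha}-\vec A^+_{c_0,1}|\le C(c_0)\sqrt{1-\alpha},\quad\text{for all }\alpha\in[1/2,1].$$ Here $C(c_0)$ is a positive constant depending on $c_0$ but otherwise independent of $\alpha$.
   Context: For $\alpha\in[0,1]$ put $\beta=\sqrt{1-\alpha^2}$. For $c_0>0$, $\{\vec m_{c_0,\alpha},\vec n_{c_0,\alpha},\vec b_{c_0,\alpha}\}$ denotes the unique global solution on $\mathbb R$ of the Serret--Frenet system $$\vec m'=c\,\vec n,\qquad \vec n'=-c\,\vec m+\tau\,\vec b,\qquad \vec b'=-\tau\,\vec n,$$ with $c(s)=c_0e^{-\alpha s^2/4}$, $\tau(s)=\beta s/2$ and $\vec m(0)=(1,0,0)$, $\vec n(0)=(0,1,0)$, $\vec b(0)=(0,0,1)$. The limiting vector is $\vec A^+_{c_0,\alpha}:=\lim_{s\to+\infty}\vec m_{c_0,\alpha}(s)\in\mathbb S^2$ (this limit exists). *)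

theory Defs
  imports "HOL-Analysis.Analysis"
begin

definition curvature :: "real \<Rightarrow> real \<Rightarrow> real \<Rightarrow> real" where
  "curvature c0 \<alpha> s = c0 * exp (- \<alpha> * s\<^sup>2 / 4)"

definition torsion :: "real \<Rightarrow> real \<Rightarrow> real" where
  "torsion \<alpha> s = sqrt (1 - \<alpha>\<^sup>2) * s / 2"

definition frenet_solution ::
  "real \<Rightarrow> real \<Rightarrow> (real \<Rightarrow> real ^ 3) \<times> (real \<Rightarrow> real ^ 3) \<times> (real \<Rightarrow> real ^ 3) \<Rightarrow> bool" where
  "frenet_solution c0 \<alpha> = (\<lambda>(m, n, b).
     m 0 = vector [1, 0, 0] \<and> n 0 = vector [0, 1, 0] \<and> b 0 = vector [0, 0, 1] \<and>
     (\<forall>s. (m has_vector_derivative curvature c0 \<alpha> s *\<^sub>R n s) (at s) \<and>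
          (n has_vector_derivative
             - curvature c0 \<alpha> s *\<^sub>R m s + torsion \<alpha> s *\<^sub>R b s) (at s) \<and>
          (b has_vector_derivative - torsion \<alpha> s *\<^sub>R n s) (at s)))"

(* The system is linear with continuous coefficients, so for 0 \<le> \<alpha> \<le> 1 the solution on the
   whole line exists and is unique, and the description below is proper. *)
definition frenet_frame ::
  "real \<Rightarrow> real \<Rightarrow> (real \<Rightarrow> real ^ 3) \<times> (real \<Rightarrow> real ^ 3) \<times> (real \<Rightarrow> real ^ 3)" where
  "frenet_frame c0 \<alpha> = (THE F. frenet_solution c0 \<alpha> F)"

definition tangent :: "real \<Rightarrow> real \<Rightarrow> real \<Rightarrow> real ^ 3" where
  "tangent c0 \<alpha> = fst (frenet_frame c0 \<alpha>)"

definition A_plus :: "real \<Rightarrow> real \<Rightarrow> real ^ 3" where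
  "A_plus c0 \<alpha> = Lim at_top (tangent c0 \<alpha>)"

end

theory Submission imports Defs begin

text \<open>
  Turning the normal plane along with the torsion makes the Serret--Frenet system a skew-symmetric
  linear system with a single complex coefficient. If \<open>x = u \<bullet> m\<close> is the tangential and \<open>z\<close> the
  turned normal coordinate of a fixed vector \<open>u\<close>, then \<open>x' = q \<bullet> z\<close> and \<open>z' = - x q\<close>, where
  \<open>q s = c0 exp (- w s\<^sup>2 / 4)\<close> and \<open>w = \<alpha> - \<i> sqrt (1 - \<alpha>\<^sup>2)\<close> lies on the unit circle. The number \<open>w\<close>
  carries the whole dependence on \<open>\<alpha>\<close>.

  Since \<open>q\<close> oscillates faster and faster or decays, integration by parts gains a factor \<open>1 / s\<close>, and
  the tangent is within \<open>C / s\<close> of its limit with \<open>C\<close> independent of \<open>\<alpha>\<close> (\<open>slow_variation\<close>). At a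
  fixed time the tangent depends continuously on \<open>\<alpha>\<close>, so the limit does too, by uniform convergence.

  For the rates, two parameters are compared through the pairing \<open>p x + r \<bullet> z\<close> of two solutions
  \<open>(p, r)\<close> and \<open>(x, z)\<close> with coefficients \<open>q\<^sub>0\<close> and \<open>q\<close>. Its derivative is of the size of \<open>q - q\<^sub>0\<close>, and
  no exponential growth enters. Near \<open>\<alpha> = 1\<close> all coefficients are uniformly damped, so
  \<open>q - q\<^sub>0\<close> is integrable with an integral of order \<open>norm (w - w\<^sub>0)\<close>, which is of order
  \<open>sqrt (1 - \<alpha>)\<close> (\<open>A_plus_near_one\<close>).

  Near \<open>\<alpha> = 0\<close> there is hardly any damping, and \<open>q - q\<^sub>0\<close> grows like \<open>\<alpha> s\<^sup>2\<close>. Here \<open>(p, r)\<close> is taken to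
  be the solution for the parameter \<open>0\<close> that tends to the purely tangential state at infinity; these
  are the coordinates of the limiting vector itself. Then \<open>r\<close> decays like \<open>1 / s\<close>. After an
  integration by parts the pairing drifts by no more than a multiple of \<open>\<alpha> S\<close> up to time \<open>S\<close>
  (\<open>pairing_drift\<close>): the only term that could spoil this is resonant, and its main part vanishes
  because \<open>w\<^sub>0 = - \<i>\<close> is purely imaginary. With the tail \<open>C / S\<close> and \<open>S = 1 / sqrt \<alpha>\<close> this gives a
  bound of order \<open>sqrt \<alpha>\<close> (\<open>A_plus_near_zero\<close>).
\<close>

section \<open>Increments, inner products and duality\<close>

lemma increment_bound:
  fixes f :: "real \<Rightarrow> 'a::real_normed_vector"
  assumes "a \<le> b"
    and "\<And>x. a \<le> x \<Longrightarrow> x \<le> b \<Longrightarrow> (f has_vector_derivative f' x) (at x)"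
    and "\<And>x. a \<le> x \<Longrightarrow> x \<le> b \<Longrightarrow> (h has_real_derivative h' x) (at x)"
    and "\<And>x. a \<le> x \<Longrightarrow> x \<le> b \<Longrightarrow> norm (f' x) \<le> h' x"
  shows "norm (f b - f a) \<le> h b - h a"
proof (cases "a = b")
  case False
  show ?thesis
  proof (rule differentiable_bound_general[where f' = f' and \<phi>' = h'])
    show "continuous_on {a..b} f"
      using has_vector_derivative_continuous[OF assms(2)]
      by (auto intro: continuous_at_imp_continuous_on)
    show "continuous_on {a..b} h"
      using DERIV_isCont[OF assms(3)] by (auto intro: continuous_at_imp_continuous_on)
  qed (use assms False in \<open>auto simp: has_real_derivative_iff_has_vector_derivative\<close>)
qed simp

lemma has_real_derivative_inner:
  assumes "(f has_vector_derivative f') (at s)" "(g has_vector_derivative g') (at s)"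
  shows "((\<lambda>t. f t \<bullet> g t) has_real_derivative f s \<bullet> g' + f' \<bullet> g s) (at s)"
  using bounded_bilinear.has_vector_derivative[OF bounded_bilinear_inner assms]
  by (simp add: has_real_derivative_iff_has_vector_derivative)

lemma constant_if_derivative_zero:
  fixes f :: "real \<Rightarrow> real"
  assumes "\<And>t. (f has_real_derivative 0) (at t)"
  shows "f s = f 0"
  using DERIV_isconst_all[of f s 0] assms by blast

lemma abs_inner_le:
  fixes a b :: "'a::real_inner"
  assumes "norm a \<le> A" "norm b \<le> B"
  shows "\<bar>a \<bullet> b\<bar> \<le> A * B"
  using Cauchy_Schwarz_ineq2[of a b] mult_mono[OF assms] norm_ge_zero[of a] norm_ge_zero[of b] assms(1)
  by linarith

lemma abs_mult_le:
  fixes a b :: real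
  assumes "\<bar>a\<bar> \<le> A" "\<bar>b\<bar> \<le> B"
  shows "\<bar>a * b\<bar> \<le> A * B"
  using mult_mono[OF assms] assms by (simp add: abs_mult)

lemma norm_le_by_duality:
  fixes v :: "'a::real_inner"
  assumes "\<And>u. norm u \<le> 1 \<Longrightarrow> \<bar>u \<bullet> v\<bar> \<le> B"
  shows "norm v \<le> B"
proof (cases "v = 0")
  case True
  then show ?thesis using assms[of 0] by simp
next
  case False
  have "\<bar>(v /\<^sub>R norm v) \<bullet> v\<bar> \<le> B" using False by (intro assms) simp
  moreover have "(v /\<^sub>R norm v) \<bullet> v = norm v"
    using False by (simp add: power2_norm_eq_inner[symmetric] power2_eq_square)
  ultimately show ?thesis by simp
qed

section \<open>Global solutions of Lipschitz differential equations\<close>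

lemma antiderivative_exists:
  fixes g :: "real \<Rightarrow> 'a::euclidean_space"
  assumes "continuous_on UNIV g"
  obtains G where "\<And>t. (G has_vector_derivative g t) (at t)" "G 0 = 0"
proof -
  have "\<exists>F. \<forall>x::real. - \<infinity> < ereal x \<longrightarrow> ereal x < \<infinity> \<longrightarrow> (F has_vector_derivative g x) (at x)"
    by (rule einterval_antiderivative)
      (use assms in \<open>auto simp: continuous_on_eq_continuous_at\<close>)
  then obtain F where F: "\<And>x. (F has_vector_derivative g x) (at x)" by auto
  show thesis
    by (rule that[of "\<lambda>t. F t - F 0"]) (auto intro!: derivative_eq_intros F)
qed

text \<open>Instead of continuing local solutions, one weighted contraction gives the whole line at once.
  With \<open>\<sigma>' = 2 k\<close> and the weight \<open>W = cosh \<sigma>\<close>, the weighted solution \<open>y / W\<close> is sought among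
  bounded continuous functions. The Picard operator gains a factor \<open>1/2\<close> there, because
  \<open>k cosh \<sigma>\<close> has the primitive \<open>sinh \<sigma> / 2\<close>, and \<open>\<bar>sinh \<sigma>\<bar> \<le> cosh \<sigma>\<close>. This even weight with an odd
  primitive serves positive and negative times alike.\<close>

theorem global_ode_solution_exists:
  fixes f :: "real \<Rightarrow> 'a::euclidean_space \<Rightarrow> 'a" and k :: "real \<Rightarrow> real"
  assumes cont: "\<And>u. continuous_on UNIV u \<Longrightarrow> continuous_on UNIV (\<lambda>t. f t (u t))"
    and contk: "continuous_on UNIV k"
    and lip: "\<And>t u v. norm (f t u - f t v) \<le> k t * norm (u - v)"
    and zero: "\<And>t. norm (f t 0) \<le> k t"
  obtains y where "y 0 = y0" "\<And>t. (y has_vector_derivative f t (y t)) (at t)"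
proof -
  have k0: "k t \<ge> 0" for t
    using zero[of t] norm_ge_zero order_trans by blast
  have "continuous_on UNIV (\<lambda>t. 2 * k t)" by (intro continuous_intros contk)
  then obtain \<sigma> where "\<And>t. (\<sigma> has_vector_derivative 2 * k t) (at t)" and \<sigma>0: "\<sigma> 0 = 0"
    by (rule antiderivative_exists) blast
  then have \<sigma>: "(\<sigma> has_real_derivative 2 * k t) (at t)" for t
    by (simp add: has_real_derivative_iff_has_vector_derivative)
  have cont\<sigma>: "continuous_on UNIV \<sigma>"
    using \<sigma> DERIV_isCont by (blast intro: continuous_at_imp_continuous_on)
  define W where "W t = cosh (\<sigma> t)" for t
  have W1: "W t \<ge> 1" for t by (simp add: W_def cosh_real_ge_1)
  then have Wpos: "W t > 0" for t by (smt (verit))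
  have contW: "continuous_on UNIV W"
    unfolding W_def by (intro continuous_intros cont\<sigma>)
  have major: "norm (G t) \<le> B / 2 * W t"
    if G: "\<And>t. (G has_vector_derivative g t) (at t)" "G 0 = 0"
      and g: "\<And>t. norm (g t) \<le> B * (k t * W t)" and B: "B \<ge> 0"
    for G g :: "real \<Rightarrow> 'a" and B t
  proof -
    have h: "((\<lambda>t. B / 2 * sinh (\<sigma> t)) has_real_derivative B * (k t * W t)) (at t)" for t
      unfolding W_def by (auto intro!: derivative_eq_intros \<sigma>)
    have "norm (G t) \<le> B / 2 * \<bar>sinh (\<sigma> t)\<bar>"
    proof (cases "0 \<le> t")
      case True
      have "norm (G t - G 0) \<le> B / 2 * sinh (\<sigma> t) - B / 2 * sinh (\<sigma> 0)"
        by (rule increment_bound[OF True G(1) h g])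
      also have "\<dots> \<le> B / 2 * \<bar>sinh (\<sigma> t)\<bar>"
        using mult_left_mono[of "sinh (\<sigma> t)" "\<bar>sinh (\<sigma> t)\<bar>" B] B by (auto simp: \<sigma>0)
      finally show ?thesis using G by simp
    next
      case False
      have "norm (G 0 - G t) \<le> B / 2 * sinh (\<sigma> 0) - B / 2 * sinh (\<sigma> t)"
        by (rule increment_bound[OF _ G(1) h g]) (use False in auto)
      also have "\<dots> \<le> B / 2 * \<bar>sinh (\<sigma> t)\<bar>"
        using mult_left_mono[of "- sinh (\<sigma> t)" "\<bar>sinh (\<sigma> t)\<bar>" B] B by (auto simp: \<sigma>0)
      finally show ?thesis using G by simp
    qed
    also have "\<bar>sinh (\<sigma> t)\<bar> \<le> W t"
    proof -
      have "sinh \<bar>\<sigma> t\<bar> \<le> cosh \<bar>\<sigma> t\<bar>" by (rule sinh_le_cosh_real)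
      then show ?thesis by (simp add: W_def)
    qed
    finally show ?thesis using B by (simp add: mult_left_mono)
  qed
  define rhs where "rhs w t = f t (W t *\<^sub>R apply_bcontfun w t)" for w :: "real \<Rightarrow>\<^sub>C 'a" and t
  have "\<exists>G. \<forall>w. (\<forall>t. (G w has_vector_derivative rhs w t) (at t)) \<and> G w 0 = 0"
  proof (rule choice, rule allI)
    fix w
    have "continuous_on UNIV (rhs w)"
      unfolding rhs_def by (intro cont continuous_intros contW) simp
    then show "\<exists>G. (\<forall>t. (G has_vector_derivative rhs w t) (at t)) \<and> G 0 = 0"
      by (rule antiderivative_exists) blast
  qed
  then obtain G where G: "\<And>w t. (G w has_vector_derivative rhs w t) (at t)" "\<And>w. G w 0 = 0"
    by blast
  define T where "T w t = (y0 + G w t) /\<^sub>R W t" for w t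
  have T_bcontfun: "T w \<in> bcontfun" for w
  proof (rule bcontfun_normI)
    have "continuous_on UNIV (G w)"
      using G(1) has_vector_derivative_continuous by (blast intro: continuous_at_imp_continuous_on)
    then show "continuous_on UNIV (T w)"
      unfolding T_def using Wpos
      by (intro continuous_intros contW) (auto simp: less_imp_neq[symmetric])
    fix t
    have "norm (rhs w t) \<le> (1 + norm w) * (k t * W t)" for t
    proof -
      have "norm (rhs w t) \<le> norm (f t (W t *\<^sub>R w t) - f t 0) + norm (f t 0)"
        unfolding rhs_def using norm_triangle_sub by (metis add.commute)
      also have "\<dots> \<le> k t * (W t * norm w) + k t * W t"
      proof (rule add_mono)
        have "norm (f t (W t *\<^sub>R w t) - f t 0) \<le> k t * (W t * norm (w t))"
          using lip[of t "W t *\<^sub>R w t" 0] Wpos[of t] by simp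
        also have "\<dots> \<le> k t * (W t * norm w)"
          using k0[of t] Wpos[of t] norm_bounded[of w t] by (intro mult_left_mono) auto
        finally show "norm (f t (W t *\<^sub>R w t) - f t 0) \<le> k t * (W t * norm w)" .
        show "norm (f t 0) \<le> k t * W t"
          using zero[of t] mult_left_mono[OF W1[of t] k0[of t]] by simp
      qed
      finally show ?thesis by (simp add: algebra_simps)
    qed
    then have "norm (G w t) \<le> (1 + norm w) / 2 * W t"
      using major[OF G(1) G(2)] by simp
    moreover have "norm y0 \<le> norm y0 * W t"
      using mult_left_mono[OF W1[of t], of "norm y0"] by simp
    ultimately have "norm (y0 + G w t) \<le> (norm y0 + (1 + norm w) / 2) * W t"
      using norm_triangle_ineq[of y0 "G w t"] unfolding distrib_right by linarith
    then have "norm (y0 + G w t) / W t \<le> norm y0 + (1 + norm w) / 2"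
      using Wpos[of t] by (simp only: pos_divide_le_eq)
    then show "norm (T w t) \<le> norm y0 + (1 + norm w) / 2"
      unfolding T_def norm_scaleR using Wpos[of t] by (simp add: field_simps)
  qed
  have "\<exists>!w. Bcontfun (T w) = w"
  proof (rule banach_fix_type[where c = "1/2"])
    show "\<forall>v w. dist (Bcontfun (T v)) (Bcontfun (T w)) \<le> 1 / 2 * dist v w"
    proof (intro allI dist_bound)
      fix v w t
      have "norm (rhs v t - rhs w t) \<le> norm (v - w) * (k t * W t)" for t
      proof -
        have "norm (rhs v t - rhs w t) \<le> k t * norm (W t *\<^sub>R v t - W t *\<^sub>R w t)"
          unfolding rhs_def by (rule lip)
        also have "\<dots> = k t * (W t * norm ((v - w) t))"
          using Wpos[of t] by (simp flip: scaleR_diff_right)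
        also have "\<dots> \<le> k t * (W t * norm (v - w))"
          using k0[of t] Wpos[of t] norm_bounded[of "v - w" t] by (intro mult_left_mono) auto
        finally show ?thesis by (simp add: algebra_simps)
      qed
      moreover have "((\<lambda>t. G v t - G w t) has_vector_derivative rhs v t - rhs w t) (at t)" for t
        by (intro derivative_intros G)
      ultimately have "norm (G v t - G w t) \<le> norm (v - w) / 2 * W t"
        using major[of "\<lambda>t. G v t - G w t" "\<lambda>t. rhs v t - rhs w t"] by (simp add: G)
      then have "norm ((G v t - G w t) /\<^sub>R W t) \<le> norm (v - w) / 2"
        unfolding norm_scaleR using Wpos[of t] by (simp add: field_simps)
      moreover have "T v t - T w t = (G v t - G w t) /\<^sub>R W t"
        unfolding T_def by (simp add: algebra_simps)
      ultimately show "dist (Bcontfun (T v) t) (Bcontfun (T w) t) \<le> 1 / 2 * dist v w"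
        by (simp add: Bcontfun_inverse T_bcontfun dist_norm)
    qed
  qed auto
  then obtain w where w: "Bcontfun (T w) = w" by blast
  have fixpoint: "W t *\<^sub>R w t = y0 + G w t" for t
  proof -
    have "w t = T w t" by (metis w Bcontfun_inverse T_bcontfun)
    then show ?thesis unfolding T_def using Wpos[of t] by simp
  qed
  show thesis
  proof (rule that[of "\<lambda>t. y0 + G w t"])
    show "y0 + G w 0 = y0" by (simp add: G)
    show "((\<lambda>t. y0 + G w t) has_vector_derivative f t (y0 + G w t)) (at t)" for t
      using G(1)[of w t] by (auto intro!: derivative_eq_intros simp: rhs_def fixpoint)
  qed
qed

section \<open>Rotating pairs\<close>

text \<open>A vector of three-space, read in a moving frame, is stored as its tangential coordinate \<open>x\<close>
  (real) and its normal coordinates \<open>z\<close> (complex). The generator is skew-symmetric on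
  \<open>real \<times> complex\<close>, so the flow consists of rotations.\<close>

definition rotates :: "(real \<Rightarrow> complex) \<Rightarrow> (real \<Rightarrow> real) \<Rightarrow> (real \<Rightarrow> complex) \<Rightarrow> bool" where
  "rotates q x z \<longleftrightarrow> (\<forall>s. (x has_real_derivative q s \<bullet> z s) (at s) \<and>
     (z has_vector_derivative - (x s *\<^sub>R q s)) (at s))"

text \<open>The inner product of two rotating pairs feels only the difference of their coefficients. All
  comparisons below are made through this product: it respects the conservation law, and a solution with known
  decay can be chosen as one of the two factors.\<close>

lemma pairing_derivative:
  assumes "rotates q\<^sub>0 p r" "rotates q x z"
  shows "((\<lambda>s. p s * x s + r s \<bullet> z s) has_real_derivative
      p s * ((q s - q\<^sub>0 s) \<bullet> z s) - x s * (r s \<bullet> (q s - q\<^sub>0 s))) (at s)"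
proof -
  have p: "(p has_real_derivative q\<^sub>0 s \<bullet> r s) (at s)"
    and r: "(r has_vector_derivative - (p s *\<^sub>R q\<^sub>0 s)) (at s)"
    and x: "(x has_real_derivative q s \<bullet> z s) (at s)"
    and z: "(z has_vector_derivative - (x s *\<^sub>R q s)) (at s)"
    using assms by (auto simp: rotates_def)
  show ?thesis
    by (rule derivative_eq_intros has_real_derivative_inner p r x z refl)+
      (simp add: algebra_simps inner_diff_left inner_diff_right inner_commute)
qed

lemma pairing_constant:
  assumes "rotates q p r" "rotates q x z"
  shows "p s * x s + r s \<bullet> z s = p 0 * x 0 + r 0 \<bullet> z 0"
  by (rule constant_if_derivative_zero[of "\<lambda>s. p s * x s + r s \<bullet> z s"])
    (use pairing_derivative[OF assms] in simp)

lemma rotates_norm_constant: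
  assumes "rotates q x z"
  shows "(x s)\<^sup>2 + (norm (z s))\<^sup>2 = (x 0)\<^sup>2 + (norm (z 0))\<^sup>2"
  using pairing_constant[OF assms assms, of s]
  by (simp add: power2_norm_eq_inner flip: power2_eq_square)

lemma pairing_increment:
  assumes p: "rotates q\<^sub>0 p r" and x: "rotates q x z"
    and unit: "\<And>s. \<bar>p s\<bar> \<le> 1" "\<And>s. norm (r s) \<le> 1" "\<And>s. \<bar>x s\<bar> \<le> 1" "\<And>s. norm (z s) \<le> 1"
    and "a \<le> b"
    and h: "\<And>s. a \<le> s \<Longrightarrow> s \<le> b \<Longrightarrow> (h has_real_derivative h' s) (at s)"
    and bound: "\<And>s. a \<le> s \<Longrightarrow> s \<le> b \<Longrightarrow> 2 * norm (q s - q\<^sub>0 s) \<le> h' s"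
  shows "\<bar>(p b * x b + r b \<bullet> z b) - (p a * x a + r a \<bullet> z a)\<bar> \<le> h b - h a"
proof -
  let ?d = "\<lambda>s. q s - q\<^sub>0 s"
  have "norm ((\<lambda>s. p s * x s + r s \<bullet> z s) b - (\<lambda>s. p s * x s + r s \<bullet> z s) a) \<le> h b - h a"
  proof (rule increment_bound[OF \<open>a \<le> b\<close> _ h])
    fix s assume s: "a \<le> s" "s \<le> b"
    show "((\<lambda>s. p s * x s + r s \<bullet> z s) has_vector_derivative
        p s * (?d s \<bullet> z s) - x s * (r s \<bullet> ?d s)) (at s)"
      using pairing_derivative[OF p x] by (simp add: has_real_derivative_iff_has_vector_derivative)
    have "\<bar>?d s \<bullet> z s\<bar> \<le> norm (?d s) * 1"
      using Cauchy_Schwarz_ineq2 unit(4) by (blast intro: order_trans mult_left_mono norm_ge_zero)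
    then have 1: "\<bar>p s * (?d s \<bullet> z s)\<bar> \<le> 1 * norm (?d s)"
      unfolding abs_mult using unit(1)[of s] by (intro mult_mono) auto
    have "\<bar>r s \<bullet> ?d s\<bar> \<le> 1 * norm (?d s)"
      using Cauchy_Schwarz_ineq2 unit(2) by (blast intro: order_trans mult_right_mono norm_ge_zero)
    then have 2: "\<bar>x s * (r s \<bullet> ?d s)\<bar> \<le> 1 * norm (?d s)"
      unfolding abs_mult using unit(3)[of s] by (intro mult_mono) auto
    show "norm (p s * (?d s \<bullet> z s) - x s * (r s \<bullet> ?d s)) \<le> h' s"
      using 1 2 bound[OF s] by simp
  qed
  then show ?thesis by simp
qed

section \<open>Gaussian chirps\<close>

text \<open>A Gaussian whose exponent has been rotated in the complex plane: the real part of \<open>w\<close> damps, the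
  imaginary part makes the phase turn quadratically.\<close>

definition chirp :: "real \<Rightarrow> complex \<Rightarrow> real \<Rightarrow> complex" where
  "chirp c w s = of_real c * exp (- w * of_real (s\<^sup>2 / 4))"

text \<open>For \<open>norm w = 1\<close> this has derivative \<open>- s / 2\<close> times the chirp. Hence \<open>- (2 / s)\<close> times it is a
  primitive of the chirp up to an error of order \<open>1 / s\<^sup>2\<close>, which is what every integration by parts
  below relies on.\<close>

definition chirp_primitive :: "real \<Rightarrow> complex \<Rightarrow> real \<Rightarrow> complex" where
  "chirp_primitive c w s = cnj w * chirp c w s"

lemma chirp_derivative:
  "(chirp c w has_vector_derivative - ((s / 2) *\<^sub>R (w * chirp c w s))) (at s)"
proof -
  have "((\<lambda>u. of_real c * exp (- w * u\<^sup>2 / 4)) has_field_derivative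
      - ((of_real s / 2) * (w * (of_real c * exp (- w * (of_real s)\<^sup>2 / 4))))) (at (of_real s))"
    by (rule derivative_eq_intros refl | simp)+
  from has_vector_derivative_real_field[OF this]
  show ?thesis
    by (simp add: chirp_def[abs_def] scaleR_conv_of_real)
qed

lemma norm_chirp: "norm (chirp c w s) = \<bar>c\<bar> * exp (- Re w * (s\<^sup>2 / 4))"
  by (simp add: chirp_def norm_mult flip: of_real_power)

lemma norm_chirp_le:
  assumes "c \<ge> 0" "Re w \<ge> 0"
  shows "norm (chirp c w s) \<le> c"
  using assms by (simp add: norm_chirp mult_left_le)

lemma norm_exp_diff_le:
  fixes a b :: complex
  assumes "Re a \<le> M" "Re b \<le> M"
  shows "norm (exp a - exp b) \<le> exp M * norm (a - b)"
proof (rule field_differentiable_bound[where S = "{z. Re z \<le> M}"])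
  show "convex {z. Re z \<le> M}" by (rule convex_halfspace_Re_le)
qed (use assms in \<open>auto intro!: derivative_eq_intros\<close>)

lemma norm_chirp_diff_le:
  assumes c: "c \<ge> 0" and "\<mu> \<le> Re w" "\<mu> \<le> Re v"
  shows "norm (chirp c w s - chirp c v s) \<le> c * norm (w - v) * (s\<^sup>2 / 4) * exp (- \<mu> * (s\<^sup>2 / 4))"
proof -
  let ?t = "s\<^sup>2 / 4"
  have "norm (exp (- w * of_real ?t) - exp (- v * of_real ?t)) \<le>
      exp (- \<mu> * ?t) * norm (- w * of_real ?t - - v * of_real ?t)"
    by (rule norm_exp_diff_le)
      (use assms in \<open>auto intro!: divide_right_mono mult_right_mono simp flip: of_real_power\<close>)
  also have "- w * of_real ?t - - v * of_real ?t = of_real ?t * (v - w)"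
    by (simp add: algebra_simps)
  also have "norm \<dots> = ?t * norm (w - v)"
    unfolding norm_mult norm_of_real by (simp add: norm_minus_commute)
  finally have "c * norm (exp (- w * of_real ?t) - exp (- v * of_real ?t)) \<le>
      c * (exp (- \<mu> * ?t) * (?t * norm (w - v)))"
    using c by (rule mult_left_mono)
  moreover have "chirp c w s - chirp c v s = of_real c * (exp (- w * of_real ?t) - exp (- v * of_real ?t))"
    by (simp add: chirp_def algebra_simps)
  ultimately show ?thesis using c by (simp only: norm_mult norm_of_real) (simp add: algebra_simps)
qed

lemma chirp_primitive_derivative:
  assumes "norm w = 1"
  shows "(chirp_primitive c w has_vector_derivative - ((s / 2) *\<^sub>R chirp c w s)) (at s)"
proof -
  have *: "cnj w * (w * chirp c w s) = chirp c w s"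
    using assms complex_norm_square[of w] by (simp add: mult.assoc[symmetric] mult.commute)
  show ?thesis
    using has_vector_derivative_mult_right[OF chirp_derivative, of "cnj w" c w s]
    by (simp add: chirp_primitive_def[abs_def] *)
qed

lemma norm_chirp_primitive: "norm w = 1 \<Longrightarrow> norm (chirp_primitive c w s) = norm (chirp c w s)"
  by (simp add: chirp_primitive_def norm_mult)

lemma chirp_primitive_inner_chirp: "chirp_primitive c w s \<bullet> chirp c w s = Re w * (norm (chirp c w s))\<^sup>2"
  unfolding chirp_primitive_def inner_complex_def cmod_power2 by (simp add: algebra_simps power2_eq_square)

section \<open>Integration by parts against the chirp\<close>

text \<open>Adding the boundary term of the integration by parts cancels the oscillating derivative of \<open>x\<close>.
  What is left is of order \<open>1 / s\<^sup>2\<close>, together with a resonant term of order \<open>1 / s\<close>.\<close>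

lemma corrected_derivative:
  assumes "rotates (chirp c w) x z" and w: "norm w = 1" and s: "s \<noteq> 0"
  shows "((\<lambda>s. x s + (2 / s) * (chirp_primitive c w s \<bullet> z s)) has_real_derivative
      - (2 / s\<^sup>2) * (chirp_primitive c w s \<bullet> z s) - (2 / s) * (x s * (chirp_primitive c w s \<bullet> chirp c w s))) (at s)"
proof -
  have x: "(x has_real_derivative chirp c w s \<bullet> z s) (at s)"
    and z: "(z has_vector_derivative - (x s *\<^sub>R chirp c w s)) (at s)"
    using assms by (auto simp: rotates_def)
  show ?thesis
    by (rule derivative_eq_intros has_real_derivative_inner x z chirp_primitive_derivative[OF w] refl s)+
      (use s in \<open>simp add: field_simps power2_eq_square\<close>)
qed

text \<open>The bound depends on \<open>c\<close> only, although for small \<open>Re w\<close> the chirp is hardly damped. The resonant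
  term left by the correction is proportional to \<open>Re w * \<bar>chirp\<bar>\<^sup>2 / s\<close>, and
  \<open>Re w * exp (- Re w * s\<^sup>2 / 2) \<le> 2 / s\<^sup>2\<close> because \<open>u exp (- u) \<le> 1\<close>: the factor \<open>Re w\<close> pays for
  the missing damping.\<close>

lemma slow_variation:
  assumes rot: "rotates (chirp c w) x z"
    and x1: "\<And>s. \<bar>x s\<bar> \<le> 1" and z1: "\<And>s. norm (z s) \<le> 1"
    and c: "c \<ge> 0" and w: "norm w = 1" "Re w \<ge> 0" and st: "1 \<le> s" "s \<le> t"
  shows "\<bar>x t - x s\<bar> \<le> (6 * c + 4 * c\<^sup>2) / s"
proof -
  let ?e = "chirp_primitive c w" and ?q = "chirp c w"
  let ?y = "\<lambda>s. x s + (2 / s) * (?e s \<bullet> z s)"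
  let ?y' = "\<lambda>s. - (2 / s\<^sup>2) * (?e s \<bullet> z s) - (2 / s) * (x s * (?e s \<bullet> ?q s))"
  define K where "K = 2 * c + 4 * c\<^sup>2"
  have ez: "\<bar>?e r \<bullet> z r\<bar> \<le> c" for r
    using abs_inner_le[of "?e r" c "z r" 1] norm_chirp_le[OF c w(2), of r] z1[of r] w(1)
    by (simp add: norm_chirp_primitive)
  have "norm (?y t - ?y s) \<le> - K / t - - K / s"
  proof (rule increment_bound[OF st(2)])
    fix r assume r: "s \<le> r" "r \<le> t"
    then have r1: "r \<ge> 1" using st by simp
    show "(?y has_vector_derivative ?y' r) (at r)"
      using corrected_derivative[OF rot w(1)] r1 by (simp add: has_real_derivative_iff_has_vector_derivative)
    show "((\<lambda>r. - K / r) has_real_derivative K / r\<^sup>2) (at r)"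
      using r1 by (auto intro!: derivative_eq_intros simp: power2_eq_square)
    have "\<bar>?e r \<bullet> ?q r\<bar> \<le> c\<^sup>2 * (2 / r\<^sup>2)"
    proof -
      let ?u = "Re w * (r\<^sup>2 / 2)"
      have u: "?u \<ge> 0" using w(2) by simp
      have "(norm (?q r))\<^sup>2 = c\<^sup>2 * exp (- ?u)"
        unfolding norm_chirp power_mult_distrib power2_abs by (simp flip: exp_double)
      then have "?e r \<bullet> ?q r = c\<^sup>2 * (2 / r\<^sup>2) * (?u * exp (- ?u))"
        unfolding chirp_primitive_inner_chirp using r1 by simp
      moreover have "?u * exp (- ?u) \<ge> 0" using w(2) by simp
      moreover have "?u * exp (- ?u) \<le> 1"
        using exp_ge_add_one_self[of ?u] by (simp add: exp_minus divide_simps)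
      ultimately show ?thesis
        using abs_mult_le[of "c\<^sup>2 * (2 / r\<^sup>2)" _ "?u * exp (- ?u)" 1, OF order_refl]
        by (simp only: abs_of_nonneg) simp
    qed
    then have xe: "\<bar>x r * (?e r \<bullet> ?q r)\<bar> \<le> 1 * (c\<^sup>2 * (2 / r\<^sup>2))"
      by (rule abs_mult_le[OF x1])
    have "\<bar>2 / r\<bar> \<le> 2" using r1 by (simp add: divide_simps)
    from abs_mult_le[OF this xe]
    have "\<bar>(2 / r) * (x r * (?e r \<bullet> ?q r))\<bar> \<le> 2 * (c\<^sup>2 * (2 / r\<^sup>2))"
      by simp
    moreover have "\<bar>- (2 / r\<^sup>2) * (?e r \<bullet> z r)\<bar> \<le> (2 / r\<^sup>2) * c"
      by (intro abs_mult_le ez) simp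
    ultimately have "\<bar>?y' r\<bar> \<le> (2 / r\<^sup>2) * c + 2 * (c\<^sup>2 * (2 / r\<^sup>2))" by linarith
    also have "\<dots> = K / r\<^sup>2" unfolding K_def add_divide_distrib by simp
    finally show "norm (?y' r) \<le> K / r\<^sup>2" by simp
  qed
  moreover have "K / t \<ge> 0" using c st by (simp add: K_def)
  moreover have "\<bar>(2 / r) * (?e r \<bullet> z r)\<bar> \<le> 2 / s * c" if "r \<ge> s" for r
    using that st by (intro abs_mult_le ez) (auto simp: divide_simps)
  from this[of s] this[of t] have "\<bar>(2 / s) * (?e s \<bullet> z s)\<bar> \<le> 2 / s * c" "\<bar>(2 / t) * (?e t \<bullet> z t)\<bar> \<le> 2 / s * c"
    using st by auto
  ultimately have "\<bar>x t - x s\<bar> \<le> K / s + 2 * (2 / s * c)"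
    unfolding real_norm_def by linarith
  also have "\<dots> = (6 * c + 4 * c\<^sup>2) / s" unfolding K_def add_divide_distrib by simp
  finally show ?thesis .
qed

text \<open>Integration by parts for the pairing. The terms that contain \<open>d\<close> undivided cancel, and the resonant
  contributions of both factors combine into the single product \<open>E s \<bullet> d s\<close>.\<close>

lemma corrected_pairing_derivative:
  fixes c w w\<^sub>0
  defines "E \<equiv> \<lambda>s. chirp_primitive c w s - chirp_primitive c w\<^sub>0 s" and "d \<equiv> \<lambda>s. chirp c w s - chirp c w\<^sub>0 s"
  assumes pr: "rotates (chirp c w\<^sub>0) p r" and xz: "rotates (chirp c w) x z"
    and w: "norm w\<^sub>0 = 1" "norm w = 1" and s: "s \<noteq> 0"
  shows "((\<lambda>s. (p s * x s + r s \<bullet> z s) + (2 / s) * (p s * (E s \<bullet> z s) - x s * (r s \<bullet> E s)))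
    has_real_derivative
      - (2 / s\<^sup>2) * (p s * (E s \<bullet> z s) - x s * (r s \<bullet> E s))
      + (2 / s) * ((chirp c w\<^sub>0 s \<bullet> r s) * (E s \<bullet> z s) - (chirp c w s \<bullet> z s) * (r s \<bullet> E s)
          - p s * x s * (E s \<bullet> d s))) (at s)"
proof -
  let ?q = "chirp c w" and ?k = "chirp c w\<^sub>0"
  have p: "(p has_real_derivative ?k s \<bullet> r s) (at s)"
    and r: "(r has_vector_derivative - (p s *\<^sub>R ?k s)) (at s)"
    and x: "(x has_real_derivative ?q s \<bullet> z s) (at s)"
    and z: "(z has_vector_derivative - (x s *\<^sub>R ?q s)) (at s)"
    using pr xz by (auto simp: rotates_def)
  have E: "(E has_vector_derivative - ((s / 2) *\<^sub>R d s)) (at s)"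
    unfolding E_def d_def
    by (rule derivative_eq_intros chirp_primitive_derivative w refl)+ (simp add: algebra_simps)
  have Ed: "E s \<bullet> d s = E s \<bullet> ?q s - ?k s \<bullet> E s"
    by (simp add: d_def inner_diff_right inner_commute)
  have "((\<lambda>s. p s * (E s \<bullet> z s) - x s * (r s \<bullet> E s)) has_real_derivative
      (?k s \<bullet> r s) * (E s \<bullet> z s) - (?q s \<bullet> z s) * (r s \<bullet> E s) - p s * x s * (E s \<bullet> d s)
      - (s / 2) * (p s * (d s \<bullet> z s) - x s * (r s \<bullet> d s))) (at s)"
    by (rule derivative_eq_intros has_real_derivative_inner p r x z E refl)+
      (simp add: algebra_simps Ed)
  note D = this
  show ?thesis
    by (rule derivative_eq_intros pairing_derivative[OF pr xz] D refl s)+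
      (use s in \<open>simp add: d_def field_simps power2_eq_square\<close>)
qed

text \<open>The chirps differ by about \<open>\<kappa> s\<^sup>2\<close>, where \<open>\<kappa> = norm (w - w\<^sub>0)\<close>, so a direct integration up to \<open>S\<close>
  would cost \<open>\<kappa> S\<^sup>3\<close>. After the integration by parts every term of the derivative is of order \<open>\<kappa>\<close>:
  in two of them the growth is absorbed by the decay of \<open>r\<close>, and the resonant product is small because
  \<open>w\<^sub>0\<close> is purely imaginary, so that the main part of \<open>E\<close> is \<open>d\<close> turned by a right angle. Only
  \<open>\<kappa> S\<close> remains.\<close>

lemma pairing_drift:
  assumes pr: "rotates (chirp c w\<^sub>0) p r" and xz: "rotates (chirp c w) x z"
    and unit: "\<And>s. \<bar>p s\<bar> \<le> 1" "\<And>s. norm (r s) \<le> 1" "\<And>s. \<bar>x s\<bar> \<le> 1" "\<And>s. norm (z s) \<le> 1"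
    and decay: "\<And>s. s \<ge> 1 \<Longrightarrow> norm (r s) \<le> R / s"
    and c: "c \<ge> 0" and w: "norm w\<^sub>0 = 1" "norm w = 1" "Re w\<^sub>0 = 0" "Re w \<ge> 0"
    and S: "S \<ge> 1"
  shows "\<bar>(p S * x S + r S \<bullet> z S) - (p 0 * x 0 + r 0 \<bullet> z 0)\<bar>
    \<le> (25 * c + 4 * c\<^sup>2 + 8 * c\<^sup>2 * R) * norm (w - w\<^sub>0) * S"
proof -
  let ?q = "chirp c w" and ?k = "chirp c w\<^sub>0"
  define E where "E s = chirp_primitive c w s - chirp_primitive c w\<^sub>0 s" for s
  define d where "d s = ?q s - ?k s" for s
  define \<kappa> where "\<kappa> = norm (w - w\<^sub>0)"
  define f where "f s = p s * x s + r s \<bullet> z s" for s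
  define corr where "corr s = (2 / s) * (p s * (E s \<bullet> z s) - x s * (r s \<bullet> E s))" for s
  define g' where "g' s = - (2 / s\<^sup>2) * (p s * (E s \<bullet> z s) - x s * (r s \<bullet> E s))
      + (2 / s) * ((?k s \<bullet> r s) * (E s \<bullet> z s) - (?q s \<bullet> z s) * (r s \<bullet> E s)
          - p s * x s * (E s \<bullet> d s))" for s
  have \<kappa>: "\<kappa> \<ge> 0" by (simp add: \<kappa>_def)
  have R: "R \<ge> 0" using decay[of 1] norm_ge_zero[of "r 1"] by linarith
  have q: "norm (?q s) \<le> c" and q0: "norm (?k s) \<le> c" for s
    using norm_chirp_le c w by auto
  have d: "norm (d s) \<le> c * \<kappa> * (s\<^sup>2 / 4)" for s
    using norm_chirp_diff_le[of c 0 w w\<^sub>0 s] c w by (simp add: d_def \<kappa>_def)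
  have conj_diff: "norm (cnj w - cnj w\<^sub>0) = \<kappa>"
    unfolding \<kappa>_def by (metis complex_cnj_diff complex_mod_cnj)
  have E: "norm (E s) \<le> 2 * c * \<kappa> * s\<^sup>2" if "s \<ge> 1" for s
  proof -
    have "E s = cnj w * d s + (cnj w - cnj w\<^sub>0) * ?k s"
      unfolding E_def d_def chirp_primitive_def by algebra
    then have "norm (E s) \<le> norm (cnj w * d s) + norm ((cnj w - cnj w\<^sub>0) * ?k s)"
      using norm_triangle_ineq by metis
    also have "\<dots> = norm (d s) + \<kappa> * norm (?k s)"
      by (simp add: norm_mult w conj_diff)
    also have "\<dots> \<le> c * \<kappa> * (s\<^sup>2 / 4) + \<kappa> * c"
      by (intro add_mono d mult_left_mono q0 \<kappa>)
    also have "\<dots> = c * \<kappa> * (s\<^sup>2 / 4 + 1)" by (simp add: algebra_simps)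
    also have "\<dots> \<le> c * \<kappa> * (2 * s\<^sup>2)"
    proof (rule mult_left_mono)
      show "s\<^sup>2 / 4 + 1 \<le> 2 * s\<^sup>2" using one_le_power[OF that, of 2] by linarith
    qed (use c \<kappa> in simp)
    finally show ?thesis by (simp add: algebra_simps)
  qed
  have Ed: "\<bar>E s \<bullet> d s\<bar> \<le> \<kappa> * c * (2 * c)" for s
  proof -
    have "E s = cnj w\<^sub>0 * d s + (cnj w - cnj w\<^sub>0) * ?q s"
      unfolding E_def d_def chirp_primitive_def by algebra
    \<comment> \<open>multiplication by the purely imaginary number is a quarter turn\<close>
    moreover have "(cnj w\<^sub>0 * d s) \<bullet> d s = 0"
      using w by (simp add: inner_complex_def algebra_simps)
    ultimately have "E s \<bullet> d s = ((cnj w - cnj w\<^sub>0) * ?q s) \<bullet> d s"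
      by (simp add: inner_add_left)
    moreover have "norm ((cnj w - cnj w\<^sub>0) * ?q s) \<le> \<kappa> * c"
      unfolding norm_mult conj_diff by (intro mult_left_mono q \<kappa>)
    moreover have "norm (d s) \<le> 2 * c"
      unfolding d_def using norm_triangle_ineq4[of "?q s" "?k s"] q[of s] q0[of s] by linarith
    ultimately show ?thesis by (simp add: abs_inner_le)
  qed
  have Ez: "\<bar>E s \<bullet> z s\<bar> \<le> 2 * c * \<kappa> * s\<^sup>2" if "s \<ge> 1" for s
    using abs_inner_le[OF E[OF that] unit(4)[of s]] by simp
  have rE: "\<bar>r s \<bullet> E s\<bar> \<le> R / s * (2 * c * \<kappa> * s\<^sup>2)" if "s \<ge> 1" for s
    using abs_inner_le[OF decay[OF that] E[OF that]] .
  have rE1: "\<bar>r s \<bullet> E s\<bar> \<le> 2 * c * \<kappa> * s\<^sup>2" if "s \<ge> 1" for s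
    using abs_inner_le[OF unit(2)[of s] E[OF that]] by simp
  have pE: "\<bar>p s * (E s \<bullet> z s) - x s * (r s \<bullet> E s)\<bar> \<le> 4 * c * \<kappa> * s\<^sup>2" if "s \<ge> 1" for s
    using abs_mult_le[OF unit(1)[of s] Ez[OF that]] abs_mult_le[OF unit(3)[of s] rE1[OF that]]
    by simp
  have corr: "\<bar>corr s\<bar> \<le> 8 * c * \<kappa> * S" if "1 \<le> s" "s \<le> S" for s
  proof -
    have "\<bar>corr s\<bar> \<le> 2 / s * (4 * c * \<kappa> * s\<^sup>2)"
      unfolding corr_def using that by (intro abs_mult_le pE) auto
    also have "\<dots> = 8 * c * \<kappa> * s" using that by (simp add: power2_eq_square)
    also have "\<dots> \<le> 8 * c * \<kappa> * S" using that c \<kappa> by (intro mult_left_mono) auto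
    finally show ?thesis .
  qed
  define B where "B = (8 * c + 8 * c\<^sup>2 * R + 4 * c\<^sup>2) * \<kappa>"
  have three: "\<bar>a - b - e\<bar> \<le> A + B + C" if "\<bar>a\<bar> \<le> A" "\<bar>b\<bar> \<le> B" "\<bar>e\<bar> \<le> C"
    for a b e A B C :: real
    using that by linarith
  have g': "\<bar>g' s\<bar> \<le> B" if s: "s \<ge> 1" for s
  proof -
    have "\<bar>- (2 / s\<^sup>2) * (p s * (E s \<bullet> z s) - x s * (r s \<bullet> E s))\<bar> \<le> 2 / s\<^sup>2 * (4 * c * \<kappa> * s\<^sup>2)"
      using s by (intro abs_mult_le pE) auto
    then have 1: "\<bar>- (2 / s\<^sup>2) * (p s * (E s \<bullet> z s) - x s * (r s \<bullet> E s))\<bar> \<le> 8 * c * \<kappa>"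
      using s by simp
    have 2: "\<bar>(?k s \<bullet> r s) * (E s \<bullet> z s)\<bar> \<le> c * (R / s) * (2 * c * \<kappa> * s\<^sup>2)"
      using s by (intro abs_mult_le abs_inner_le q0 decay Ez)
    have 3: "\<bar>(?q s \<bullet> z s) * (r s \<bullet> E s)\<bar> \<le> c * 1 * (R / s * (2 * c * \<kappa> * s\<^sup>2))"
      using s by (intro abs_mult_le abs_inner_le q unit rE)
    have 4: "\<bar>p s * x s * (E s \<bullet> d s)\<bar> \<le> 1 * 1 * (\<kappa> * c * (2 * c))"
      by (intro abs_mult_le unit Ed)
    have "\<bar>(?k s \<bullet> r s) * (E s \<bullet> z s) - (?q s \<bullet> z s) * (r s \<bullet> E s) - p s * x s * (E s \<bullet> d s)\<bar>
      \<le> c * (R / s) * (2 * c * \<kappa> * s\<^sup>2) + c * 1 * (R / s * (2 * c * \<kappa> * s\<^sup>2)) + 1 * 1 * (\<kappa> * c * (2 * c))"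
      by (rule three[OF 2 3 4])
    from abs_mult_le[OF _ this, of "2 / s" "2 / s"]
    have "\<bar>(2 / s) * ((?k s \<bullet> r s) * (E s \<bullet> z s) - (?q s \<bullet> z s) * (r s \<bullet> E s) - p s * x s * (E s \<bullet> d s))\<bar>
      \<le> 2 / s * (c * (R / s) * (2 * c * \<kappa> * s\<^sup>2) + c * 1 * (R / s * (2 * c * \<kappa> * s\<^sup>2)) + 1 * 1 * (\<kappa> * c * (2 * c)))"
      using s by simp
    also have "\<dots> = 8 * c\<^sup>2 * R * \<kappa> + 4 * c\<^sup>2 * \<kappa> * (1 / s)"
      using s by (simp add: field_simps power2_eq_square)
    also have "\<dots> \<le> 8 * c\<^sup>2 * R * \<kappa> + 4 * c\<^sup>2 * \<kappa> * 1"
      using s \<kappa> by (intro add_left_mono mult_left_mono) auto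
    finally show ?thesis using 1 unfolding g'_def B_def distrib_right by linarith
  qed
  have "norm ((\<lambda>s. f s + corr s) S - (\<lambda>s. f s + corr s) 1) \<le> B * S - B * 1"
  proof (rule increment_bound[OF S])
    fix s assume s: "1 \<le> s" "s \<le> S"
    show "((\<lambda>s. f s + corr s) has_vector_derivative g' s) (at s)"
      using corrected_pairing_derivative[OF pr xz w(1,2), of s] s
      by (simp add: f_def[abs_def] corr_def[abs_def] g'_def E_def d_def
          has_real_derivative_iff_has_vector_derivative)
    show "((\<lambda>s. B * s) has_real_derivative B) (at s)" by (auto intro!: derivative_eq_intros)
    show "norm (g' s) \<le> B" using g'[OF s(1)] by simp
  qed
  moreover have "B \<ge> 0" using g'[of 1] by simp
  ultimately have "\<bar>(f S + corr S) - (f 1 + corr 1)\<bar> \<le> B * S" by simp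
  \<comment> \<open>The correction is singular at the origin; on the unit interval the crude bound is enough.\<close>
  moreover have "\<bar>f 1 - f 0\<bar> \<le> c * \<kappa> * 1 - c * \<kappa> * 0"
    unfolding f_def
  proof (rule pairing_increment[OF pr xz unit])
    fix s :: real assume s: "0 \<le> s" "s \<le> 1"
    show "((\<lambda>s. c * \<kappa> * s) has_real_derivative c * \<kappa>) (at s)"
      by (auto intro!: derivative_eq_intros)
    note d[of s]
    also have "c * \<kappa> * (s\<^sup>2 / 4) \<le> c * \<kappa> * (1 / 2)"
    proof (rule mult_left_mono)
      show "s\<^sup>2 / 4 \<le> 1 / 2" using power_le_one[OF s, of 2] by linarith
    qed (use c \<kappa> in simp)
    finally have "norm (d s) \<le> c * \<kappa> * (1 / 2)" .
    then show "2 * norm (?q s - ?k s) \<le> c * \<kappa>" by (simp add: d_def)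
  qed simp
  moreover have "c * \<kappa> \<le> c * \<kappa> * S" using mult_left_mono[OF S, of "c * \<kappa>"] c \<kappa> by simp
  ultimately have "\<bar>f S - f 0\<bar> \<le> B * S + 2 * (8 * c * \<kappa> * S) + c * \<kappa> * S"
    using corr[OF order_refl S] corr[OF S order_refl] by linarith
  also have "\<dots> = (25 * c + 4 * c\<^sup>2 + 8 * c\<^sup>2 * R) * \<kappa> * S"
    by (simp add: B_def algebra_simps)
  finally show ?thesis by (simp add: f_def \<kappa>_def)
qed

section \<open>The Serret--Frenet frame\<close>

text \<open>The rate for which the chirp has the curvature as its modulus and the integral of the torsion as
  its phase.
  As \<open>\<alpha>\<close> increases from \<open>0\<close> to \<open>1\<close>, it runs through a quarter of the unit circle, from \<open>- \<i>\<close> to \<open>1\<close>.\<close>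

definition rate :: "real \<Rightarrow> complex" where
  "rate \<alpha> = Complex \<alpha> (- sqrt (1 - \<alpha>\<^sup>2))"

lemma norm_rate: "\<alpha> \<in> {0..1} \<Longrightarrow> norm (rate \<alpha>) = 1"
  by (simp add: rate_def complex_norm abs_square_le_1)

lemma Re_rate [simp]: "Re (rate \<alpha>) = \<alpha>"
  by (simp add: rate_def)

definition phase :: "real \<Rightarrow> real \<Rightarrow> real" where
  "phase \<alpha> s = sqrt (1 - \<alpha>\<^sup>2) * s\<^sup>2 / 4"

lemma chirp_polar: "chirp c0 (rate \<alpha>) s = of_real (curvature c0 \<alpha> s) * cis (phase \<alpha> s)"
proof -
  have "- rate \<alpha> * of_real (s\<^sup>2 / 4) = of_real (- \<alpha> * s\<^sup>2 / 4) + \<i> * of_real (phase \<alpha> s)"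
    by (simp add: complex_eq_iff rate_def phase_def)
  then show ?thesis
    by (simp only: chirp_def exp_add exp_of_real cis_conv_exp curvature_def of_real_mult mult.assoc)
qed

text \<open>Turning the normal plane by the phase of the torsion removes the torsion from the system (a
  parallel frame); the phase reappears in the coefficient, which becomes a chirp.\<close>

lemma scalar_frenet_rotates:
  assumes x: "\<And>s. (x has_real_derivative curvature c0 \<alpha> s * y s) (at s)"
    and y: "\<And>s. (y has_real_derivative - curvature c0 \<alpha> s * x s + torsion \<alpha> s * v s) (at s)"
    and v: "\<And>s. (v has_real_derivative - torsion \<alpha> s * y s) (at s)"
  shows "rotates (chirp c0 (rate \<alpha>)) x (\<lambda>s. cis (phase \<alpha> s) * Complex (y s) (v s))"
  unfolding rotates_def
proof (intro allI conjI)
  fix s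
  let ?\<theta> = "phase \<alpha> s"
  have "a * (k * (cos ?\<theta> * cos ?\<theta>)) + a * (k * (sin ?\<theta> * sin ?\<theta>)) = a * k" for a k
    by (metis distrib_left mult_1_right sin_cos_squared_add3)
  then have "chirp c0 (rate \<alpha>) s \<bullet> (cis ?\<theta> * Complex (y s) (v s)) = curvature c0 \<alpha> s * y s"
    unfolding chirp_polar inner_complex_def by (simp add: algebra_simps)
  then show "(x has_real_derivative chirp c0 (rate \<alpha>) s \<bullet> (cis ?\<theta> * Complex (y s) (v s))) (at s)"
    using x[of s] by simp
  have \<theta>: "(phase \<alpha> has_real_derivative torsion \<alpha> s) (at s)"
    unfolding phase_def[abs_def] torsion_def by (auto intro!: derivative_eq_intros)
  have eq: "(\<lambda>s. cis (phase \<alpha> s) * Complex (y s) (v s)) =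
      (\<lambda>s. Complex (cos (phase \<alpha> s) * y s - sin (phase \<alpha> s) * v s)
        (cos (phase \<alpha> s) * v s + sin (phase \<alpha> s) * y s))"
    by (simp add: complex_eq_iff fun_eq_iff)
  have "((\<lambda>s. cos (phase \<alpha> s) * y s - sin (phase \<alpha> s) * v s) has_real_derivative
      - (x s * (curvature c0 \<alpha> s * cos ?\<theta>))) (at s)"
    by (rule derivative_eq_intros \<theta> y v refl)+ (simp add: algebra_simps)
  moreover have "((\<lambda>s. cos (phase \<alpha> s) * v s + sin (phase \<alpha> s) * y s) has_real_derivative
      - (x s * (curvature c0 \<alpha> s * sin ?\<theta>))) (at s)"
    by (rule derivative_eq_intros \<theta> y v refl)+ (simp add: algebra_simps)
  ultimately show "((\<lambda>s. cis (phase \<alpha> s) * Complex (y s) (v s)) has_vector_derivative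
      - (x s *\<^sub>R chirp c0 (rate \<alpha>) s)) (at s)"
    unfolding eq has_vector_derivative_complex_iff chirp_polar
    by (simp add: has_real_derivative_iff_has_vector_derivative)
qed

definition frenet_field ::
  "real \<Rightarrow> real \<Rightarrow> real \<Rightarrow> (real^3) \<times> (real^3) \<times> (real^3) \<Rightarrow> (real^3) \<times> (real^3) \<times> (real^3)" where
  "frenet_field c0 \<alpha> s = (\<lambda>(m, n, b). (curvature c0 \<alpha> s *\<^sub>R n,
     - curvature c0 \<alpha> s *\<^sub>R m + torsion \<alpha> s *\<^sub>R b, - torsion \<alpha> s *\<^sub>R n))"

lemma frenet_solution_exists: "\<exists>F. frenet_solution c0 \<alpha> F"
proof -
  let ?k = "\<lambda>s. 2 * (\<bar>curvature c0 \<alpha> s\<bar> + \<bar>torsion \<alpha> s\<bar>)"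
  have contc: "continuous_on UNIV (curvature c0 \<alpha>)" and contt: "continuous_on UNIV (torsion \<alpha>)"
    unfolding curvature_def[abs_def] torsion_def[abs_def] by (intro continuous_intros; simp)+
  have bound: "norm (frenet_field c0 \<alpha> s F) \<le> ?k s * norm F" for s F
  proof -
    obtain m n b where F: "F = (m, n, b)" by (cases F)
    let ?c = "curvature c0 \<alpha> s" and ?t = "torsion \<alpha> s"
    have m: "norm m \<le> norm F" and nb: "norm (n, b) \<le> norm F"
      unfolding F by (rule norm_fst_le norm_snd_le)+
    have n: "norm n \<le> norm F" and b: "norm b \<le> norm F"
      using nb norm_fst_le[of n b] norm_snd_le[of b n] by linarith+
    have "norm (frenet_field c0 \<alpha> s F) \<le> norm (?c *\<^sub>R n) + (norm (- ?c *\<^sub>R m + ?t *\<^sub>R b) + norm (- ?t *\<^sub>R n))"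
      unfolding frenet_field_def F prod.case by (meson norm_Pair_le add_left_mono order_trans)
    also have "\<dots> \<le> \<bar>?c\<bar> * norm n + ((\<bar>?c\<bar> * norm m + \<bar>?t\<bar> * norm b) + \<bar>?t\<bar> * norm n)"
      using norm_triangle_ineq[of "- ?c *\<^sub>R m" "?t *\<^sub>R b"] by simp
    also have "\<dots> \<le> \<bar>?c\<bar> * norm F + ((\<bar>?c\<bar> * norm F + \<bar>?t\<bar> * norm F) + \<bar>?t\<bar> * norm F)"
      by (intro add_mono mult_left_mono m n b) auto
    finally show ?thesis by (simp add: algebra_simps)
  qed
  have linear: "frenet_field c0 \<alpha> s F - frenet_field c0 \<alpha> s G = frenet_field c0 \<alpha> s (F - G)" for s F G
    by (cases F; cases G) (simp add: frenet_field_def algebra_simps)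
  obtain Y where Y0: "Y 0 = (vector [1, 0, 0], vector [0, 1, 0], vector [0, 0, 1])"
    and Y: "\<And>s. (Y has_vector_derivative frenet_field c0 \<alpha> s (Y s)) (at s)"
  proof (rule global_ode_solution_exists[of "frenet_field c0 \<alpha>" ?k])
    show "continuous_on UNIV (\<lambda>s. frenet_field c0 \<alpha> s (u s))" if "continuous_on UNIV u" for u
      unfolding frenet_field_def case_prod_unfold
      by (intro continuous_intros contc contt that)
    show "continuous_on UNIV ?k" by (intro continuous_intros contc contt)
    show "norm (frenet_field c0 \<alpha> s F - frenet_field c0 \<alpha> s G) \<le> ?k s * norm (F - G)" for s F G
      unfolding linear by (rule bound)
    show "norm (frenet_field c0 \<alpha> s 0) \<le> ?k s" for s
      by (simp add: frenet_field_def zero_prod_def)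
  qed blast
  have 1: "((\<lambda>s. fst (Y s)) has_vector_derivative fst (frenet_field c0 \<alpha> s (Y s))) (at s)"
   and 2: "((\<lambda>s. fst (snd (Y s))) has_vector_derivative fst (snd (frenet_field c0 \<alpha> s (Y s)))) (at s)"
   and 3: "((\<lambda>s. snd (snd (Y s))) has_vector_derivative snd (snd (frenet_field c0 \<alpha> s (Y s)))) (at s)" for s
    by (intro bounded_linear.has_vector_derivative[OF bounded_linear_fst]
        bounded_linear.has_vector_derivative[OF bounded_linear_snd] Y)+
  have "frenet_solution c0 \<alpha> (\<lambda>s. fst (Y s), \<lambda>s. fst (snd (Y s)), \<lambda>s. snd (snd (Y s)))"
    using 1 2 3 unfolding frenet_solution_def by (simp add: Y0 frenet_field_def case_prod_unfold)
  then show ?thesis by blast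
qed

definition frenet_system ::
  "real \<Rightarrow> real \<Rightarrow> (real \<Rightarrow> real^3) \<Rightarrow> (real \<Rightarrow> real^3) \<Rightarrow> (real \<Rightarrow> real^3) \<Rightarrow> bool" where
  "frenet_system c0 \<alpha> m n b \<longleftrightarrow> (\<forall>s.
     (m has_vector_derivative curvature c0 \<alpha> s *\<^sub>R n s) (at s) \<and>
     (n has_vector_derivative - curvature c0 \<alpha> s *\<^sub>R m s + torsion \<alpha> s *\<^sub>R b s) (at s) \<and>
     (b has_vector_derivative - torsion \<alpha> s *\<^sub>R n s) (at s))"

lemma frenet_system_diff:
  assumes "frenet_system c0 \<alpha> m n b" "frenet_system c0 \<alpha> m' n' b'"
  shows "frenet_system c0 \<alpha> (\<lambda>s. m s - m' s) (\<lambda>s. n s - n' s) (\<lambda>s. b s - b' s)"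
  unfolding frenet_system_def
proof (intro allI conjI)
  fix s
  have D: "(m has_vector_derivative curvature c0 \<alpha> s *\<^sub>R n s) (at s)"
    "(n has_vector_derivative - curvature c0 \<alpha> s *\<^sub>R m s + torsion \<alpha> s *\<^sub>R b s) (at s)"
    "(b has_vector_derivative - torsion \<alpha> s *\<^sub>R n s) (at s)"
    "(m' has_vector_derivative curvature c0 \<alpha> s *\<^sub>R n' s) (at s)"
    "(n' has_vector_derivative - curvature c0 \<alpha> s *\<^sub>R m' s + torsion \<alpha> s *\<^sub>R b' s) (at s)"
    "(b' has_vector_derivative - torsion \<alpha> s *\<^sub>R n' s) (at s)"
    using assms by (auto simp: frenet_system_def)
  show "((\<lambda>s. m s - m' s) has_vector_derivative curvature c0 \<alpha> s *\<^sub>R (n s - n' s)) (at s)"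
    using has_vector_derivative_diff[OF D(1,4)] by (simp add: algebra_simps)
  show "((\<lambda>s. n s - n' s) has_vector_derivative
      - curvature c0 \<alpha> s *\<^sub>R (m s - m' s) + torsion \<alpha> s *\<^sub>R (b s - b' s)) (at s)"
    using has_vector_derivative_diff[OF D(2,5)] by (simp add: algebra_simps)
  show "((\<lambda>s. b s - b' s) has_vector_derivative - torsion \<alpha> s *\<^sub>R (n s - n' s)) (at s)"
    using has_vector_derivative_diff[OF D(3,6)] by (simp add: algebra_simps)
qed

lemma frenet_system_rotates:
  assumes "frenet_system c0 \<alpha> m n b"
  shows "rotates (chirp c0 (rate \<alpha>)) (\<lambda>s. u \<bullet> m s)
    (\<lambda>s. cis (phase \<alpha> s) * Complex (u \<bullet> n s) (u \<bullet> b s))"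
proof (rule scalar_frenet_rotates)
  fix s
  have D: "(m has_vector_derivative curvature c0 \<alpha> s *\<^sub>R n s) (at s)"
    "(n has_vector_derivative - curvature c0 \<alpha> s *\<^sub>R m s + torsion \<alpha> s *\<^sub>R b s) (at s)"
    "(b has_vector_derivative - torsion \<alpha> s *\<^sub>R n s) (at s)"
    using assms by (auto simp: frenet_system_def)
  have inner: "((\<lambda>s. u \<bullet> f s) has_real_derivative u \<bullet> f') (at s)"
    if "(f has_vector_derivative f') (at s)" for f :: "real \<Rightarrow> real^3" and f'
    using has_real_derivative_inner[OF has_vector_derivative_const that, of u] by simp
  show "((\<lambda>s. u \<bullet> m s) has_real_derivative curvature c0 \<alpha> s * (u \<bullet> n s)) (at s)"
    using inner[OF D(1)] by simp
  show "((\<lambda>s. u \<bullet> n s) has_real_derivative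
      - curvature c0 \<alpha> s * (u \<bullet> m s) + torsion \<alpha> s * (u \<bullet> b s)) (at s)"
    using inner[OF D(2)] by (simp add: inner_add_right inner_diff_right)
  show "((\<lambda>s. u \<bullet> b s) has_real_derivative - torsion \<alpha> s * (u \<bullet> n s)) (at s)"
    using inner[OF D(3)] by simp
qed

lemma frenet_system_norm_constant:
  assumes "frenet_system c0 \<alpha> m n b"
  shows "(u \<bullet> m s)\<^sup>2 + ((u \<bullet> n s)\<^sup>2 + (u \<bullet> b s)\<^sup>2) = (u \<bullet> m 0)\<^sup>2 + ((u \<bullet> n 0)\<^sup>2 + (u \<bullet> b 0)\<^sup>2)"
  using rotates_norm_constant[OF frenet_system_rotates[OF assms], of u s]
  by (simp add: norm_mult cmod_power2)

lemma frenet_solution_unique: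
  assumes "frenet_solution c0 \<alpha> F" "frenet_solution c0 \<alpha> G"
  shows "F = G"
proof -
  obtain m n b m' n' b' where FG: "F = (m, n, b)" "G = (m', n', b')"
    by (metis surj_pair)
  have "frenet_system c0 \<alpha> (\<lambda>s. m s - m' s) (\<lambda>s. n s - n' s) (\<lambda>s. b s - b' s)"
    by (rule frenet_system_diff) (use assms in \<open>auto simp: FG frenet_solution_def frenet_system_def\<close>)
  from frenet_system_norm_constant[OF this]
  have "(u \<bullet> (m s - m' s))\<^sup>2 + ((u \<bullet> (n s - n' s))\<^sup>2 + (u \<bullet> (b s - b' s))\<^sup>2) = 0" for u s
    using assms by (simp add: FG frenet_solution_def)
  then have "u \<bullet> (m s - m' s) = 0 \<and> u \<bullet> (n s - n' s) = 0 \<and> u \<bullet> (b s - b' s) = 0" for u s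
    by (smt (verit) zero_le_power2 power2_eq_iff_nonneg zero_eq_power2)
  then have "m s - m' s = 0 \<and> n s - n' s = 0 \<and> b s - b' s = 0" for s
    by (metis inner_eq_zero_iff)
  then show ?thesis by (simp add: FG fun_eq_iff)
qed

lemma frenet_frame_solution: "frenet_solution c0 \<alpha> (frenet_frame c0 \<alpha>)"
  unfolding frenet_frame_def
  by (rule theI') (use frenet_solution_exists frenet_solution_unique in blast)

text \<open>The factor \<open>cis (phase \<alpha> s)\<close> passes from the normal and binormal to the parallel frame.\<close>

definition normal_coord :: "real \<Rightarrow> real \<Rightarrow> real^3 \<Rightarrow> real \<Rightarrow> complex" where
  "normal_coord c0 \<alpha> u s = cis (phase \<alpha> s) *
     Complex (u \<bullet> fst (snd (frenet_frame c0 \<alpha>)) s) (u \<bullet> snd (snd (frenet_frame c0 \<alpha>)) s)"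

lemma frame_system:
  "frenet_system c0 \<alpha> (tangent c0 \<alpha>) (fst (snd (frenet_frame c0 \<alpha>))) (snd (snd (frenet_frame c0 \<alpha>)))"
  using frenet_frame_solution[of c0 \<alpha>]
  by (auto simp: frenet_solution_def frenet_system_def tangent_def split: prod.splits)

lemma frame_initial:
  "tangent c0 \<alpha> 0 = vector [1, 0, 0]"
  "fst (snd (frenet_frame c0 \<alpha>)) 0 = vector [0, 1, 0]"
  "snd (snd (frenet_frame c0 \<alpha>)) 0 = vector [0, 0, 1]"
  using frenet_frame_solution[of c0 \<alpha>]
  by (auto simp: frenet_solution_def tangent_def split: prod.splits)

lemma coordinates_rotate:
  "rotates (chirp c0 (rate \<alpha>)) (\<lambda>s. u \<bullet> tangent c0 \<alpha> s) (normal_coord c0 \<alpha> u)"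
  unfolding normal_coord_def[abs_def] by (rule frenet_system_rotates[OF frame_system])

text \<open>All frames start at the standard basis, so pairing the coordinates of \<open>u\<close> and \<open>v\<close> at time \<open>0\<close>
  gives \<open>u \<bullet> v\<close>, also when the two frames belong to different parameters.\<close>

lemma coordinates_initial_pairing:
  "(u \<bullet> tangent c0 \<alpha> 0) * (v \<bullet> tangent c0 \<alpha>' 0) + normal_coord c0 \<alpha> u 0 \<bullet> normal_coord c0 \<alpha>' v 0 = u \<bullet> v"
  by (simp add: normal_coord_def frame_initial phase_def inner_complex_def inner_vec_def sum_3)

lemma coordinates_norm: "(u \<bullet> tangent c0 \<alpha> s)\<^sup>2 + (norm (normal_coord c0 \<alpha> u s))\<^sup>2 = (norm u)\<^sup>2"
  using rotates_norm_constant[OF coordinates_rotate, of u c0 \<alpha> s]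
    coordinates_initial_pairing[of u c0 \<alpha> u \<alpha>]
  by (simp add: power2_norm_eq_inner flip: power2_eq_square)

lemma coordinates_le:
  assumes "norm u \<le> 1"
  shows "\<bar>u \<bullet> tangent c0 \<alpha> s\<bar> \<le> 1" "norm (normal_coord c0 \<alpha> u s) \<le> 1"
proof -
  have "(norm u)\<^sup>2 \<le> 1" using assms by (simp add: abs_square_le_1)
  then have "(u \<bullet> tangent c0 \<alpha> s)\<^sup>2 \<le> 1" "(norm (normal_coord c0 \<alpha> u s))\<^sup>2 \<le> 1"
    using coordinates_norm[of u c0 \<alpha> s] zero_le_power2[of "u \<bullet> tangent c0 \<alpha> s"]
      zero_le_power2[of "norm (normal_coord c0 \<alpha> u s)"] by linarith+
  then show "\<bar>u \<bullet> tangent c0 \<alpha> s\<bar> \<le> 1" "norm (normal_coord c0 \<alpha> u s) \<le> 1"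
    by (simp_all add: abs_square_le_1)
qed

text \<open>Conservation gives Parseval's identity for \<open>m\<close>, \<open>n\<close>, \<open>b\<close>. Applied to each of the three vectors it
  bounds their lengths by \<open>1\<close>; summed over a basis it shows that the squared lengths add up to \<open>3\<close>.
  Hence all three are \<open>1\<close>.\<close>

lemma norm_tangent: "norm (tangent c0 \<alpha> s) = 1"
proof -
  let ?n = "fst (snd (frenet_frame c0 \<alpha>))" and ?b = "snd (snd (frenet_frame c0 \<alpha>))"
  have parseval: "(u \<bullet> tangent c0 \<alpha> s)\<^sup>2 + ((u \<bullet> ?n s)\<^sup>2 + (u \<bullet> ?b s)\<^sup>2) = u \<bullet> u" for u
    using coordinates_norm[of u c0 \<alpha> s] by (simp add: normal_coord_def norm_mult cmod_power2 power2_norm_eq_inner)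
  have le: "v \<bullet> v \<le> 1" if "(v \<bullet> v)\<^sup>2 \<le> v \<bullet> v" for v :: "real^3"
  proof (cases "v = 0")
    case False
    then have "v \<bullet> v > 0" by simp
    with that show ?thesis by (simp add: power2_eq_square)
  qed simp
  have "tangent c0 \<alpha> s \<bullet> tangent c0 \<alpha> s \<le> 1" "?n s \<bullet> ?n s \<le> 1" "?b s \<bullet> ?b s \<le> 1"
    using parseval[of "tangent c0 \<alpha> s"] parseval[of "?n s"] parseval[of "?b s"]
    by (auto intro!: le simp del: inner_eq_zero_iff) (smt (verit) zero_le_power2)+
  moreover have "tangent c0 \<alpha> s \<bullet> tangent c0 \<alpha> s + (?n s \<bullet> ?n s + ?b s \<bullet> ?b s) = 3"
  proof -
    have basis: "v \<bullet> v = (\<Sum>i\<in>UNIV. (axis i 1 \<bullet> v)\<^sup>2)" for v :: "real^3"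
      unfolding inner_axis' by (simp add: inner_vec_def power2_eq_square)
    have "tangent c0 \<alpha> s \<bullet> tangent c0 \<alpha> s + (?n s \<bullet> ?n s + ?b s \<bullet> ?b s) =
        (\<Sum>i\<in>UNIV. (axis i 1 \<bullet> tangent c0 \<alpha> s)\<^sup>2 + ((axis i 1 \<bullet> ?n s)\<^sup>2 + (axis i 1 \<bullet> ?b s)\<^sup>2))"
      by (simp only: basis sum.distrib)
    also have "\<dots> = (\<Sum>i\<in>UNIV. axis i 1 \<bullet> (axis i 1 :: real^3))"
      by (simp only: parseval)
    also have "\<dots> = 3" by (simp add: inner_axis')
    finally show ?thesis .
  qed
  ultimately have "tangent c0 \<alpha> s \<bullet> tangent c0 \<alpha> s = 1" by linarith
  then show ?thesis by (simp add: norm_eq_sqrt_inner)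
qed

lemma normal_coord_tangent: "normal_coord c0 \<alpha> (tangent c0 \<alpha> s) s = 0"
  using coordinates_norm[of "tangent c0 \<alpha> s" c0 \<alpha> s]
  by (simp add: norm_tangent power2_norm_eq_inner[symmetric])

section \<open>The limiting tangent and its dependence on the parameter\<close>

text \<open>Pair the coordinates of \<open>u\<close> in the frame of \<open>\<alpha>\<close> with those of the vector \<open>a = tangent c0 \<alpha>' s\<close> in
  the frame of \<open>\<alpha>'\<close>. At time \<open>0\<close> the product is \<open>u \<bullet> a\<close>; at time \<open>s\<close> the vector \<open>a\<close> is purely
  tangential, and the product is \<open>u \<bullet> tangent c0 \<alpha> s\<close>.\<close>

lemma tangent_comparison:
  assumes "0 \<le> s"
    and h: "\<And>t. 0 \<le> t \<Longrightarrow> t \<le> s \<Longrightarrow> (h has_real_derivative h' t) (at t)"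
    and bound: "\<And>t. 0 \<le> t \<Longrightarrow> t \<le> s \<Longrightarrow>
      2 * norm (chirp c0 (rate \<alpha>) t - chirp c0 (rate \<alpha>') t) \<le> h' t"
  shows "norm (tangent c0 \<alpha> s - tangent c0 \<alpha>' s) \<le> h s - h 0"
proof (rule norm_le_by_duality)
  fix u :: "real^3" assume u: "norm u \<le> 1"
  define a where "a = tangent c0 \<alpha>' s"
  have a: "norm a \<le> 1" by (simp add: a_def norm_tangent)
  have "\<bar>((a \<bullet> tangent c0 \<alpha>' s) * (u \<bullet> tangent c0 \<alpha> s) + normal_coord c0 \<alpha>' a s \<bullet> normal_coord c0 \<alpha> u s)
      - ((a \<bullet> tangent c0 \<alpha>' 0) * (u \<bullet> tangent c0 \<alpha> 0) + normal_coord c0 \<alpha>' a 0 \<bullet> normal_coord c0 \<alpha> u 0)\<bar>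
      \<le> h s - h 0"
    by (rule pairing_increment[OF coordinates_rotate coordinates_rotate
          coordinates_le[OF a] coordinates_le[OF u] \<open>0 \<le> s\<close> h bound])
  moreover have "a \<bullet> tangent c0 \<alpha>' s = 1"
    by (simp add: a_def norm_tangent flip: power2_norm_eq_inner)
  ultimately have "\<bar>u \<bullet> tangent c0 \<alpha> s - a \<bullet> u\<bar> \<le> h s - h 0"
    unfolding coordinates_initial_pairing by (simp add: a_def normal_coord_tangent)
  then show "\<bar>u \<bullet> (tangent c0 \<alpha> s - tangent c0 \<alpha>' s)\<bar> \<le> h s - h 0"
    by (simp add: a_def inner_diff_right inner_commute)
qed

lemma tangent_tail:
  assumes c0: "c0 \<ge> 0" and \<alpha>: "\<alpha> \<in> {0..1}" and "1 \<le> s" "s \<le> t"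
  shows "norm (tangent c0 \<alpha> t - tangent c0 \<alpha> s) \<le> (6 * c0 + 4 * c0\<^sup>2) / s"
proof (rule norm_le_by_duality)
  fix u :: "real^3" assume u: "norm u \<le> 1"
  show "\<bar>u \<bullet> (tangent c0 \<alpha> t - tangent c0 \<alpha> s)\<bar> \<le> (6 * c0 + 4 * c0\<^sup>2) / s"
    using slow_variation[OF coordinates_rotate coordinates_le[OF u] c0 norm_rate[OF \<alpha>]] assms
    by (simp add: inner_diff_right)
qed

lemma A_plus_limit_and_tail:
  assumes c0: "c0 \<ge> 0" and \<alpha>: "\<alpha> \<in> {0..1}"
  shows A_plus_limit: "(tangent c0 \<alpha> \<longlongrightarrow> A_plus c0 \<alpha>) at_top"
    and A_plus_tail: "s \<ge> 1 \<Longrightarrow> norm (A_plus c0 \<alpha> - tangent c0 \<alpha> s) \<le> (6 * c0 + 4 * c0\<^sup>2) / s"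
proof -
  define R where "R = 6 * c0 + 4 * c0\<^sup>2"
  have R: "R \<ge> 0" using c0 by (simp add: R_def)
  have R_lim: "((\<lambda>s. R / s) \<longlongrightarrow> 0) at_top"
    by (rule tendsto_divide_0[OF tendsto_const filterlim_at_top_imp_at_infinity[OF filterlim_ident]])
  have "Cauchy (\<lambda>k. tangent c0 \<alpha> (real k))"
  proof (rule CauchyI')
    fix e :: real assume "e > 0"
    then have "eventually (\<lambda>s. R / s < e \<and> s \<ge> 1) at_top"
      using order_tendstoD(2)[OF R_lim] eventually_ge_at_top by (simp add: eventually_conj)
    then obtain M where M: "\<And>s. s \<ge> M \<Longrightarrow> R / s < e \<and> s \<ge> 1"
      by (auto simp: eventually_at_top_linorder)
    have "dist (tangent c0 \<alpha> (real k)) (tangent c0 \<alpha> (real l)) < e"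
      if k: "k \<ge> nat \<lceil>M\<rceil>" and l: "l > k" for k l
    proof -
      have "real k \<ge> M" using k by linarith
      from M[OF this] tangent_tail[OF c0 \<alpha>, of "real k" "real l"] l
      show ?thesis by (simp add: R_def dist_norm norm_minus_commute)
    qed
    then show "\<exists>M. \<forall>k\<ge>M. \<forall>l>k. dist (tangent c0 \<alpha> (real k)) (tangent c0 \<alpha> (real l)) < e"
      by blast
  qed
  then obtain A where A: "(\<lambda>k. tangent c0 \<alpha> (real k)) \<longlonglongrightarrow> A"
    using Cauchy_convergent convergent_def by blast
  have tail: "norm (A - tangent c0 \<alpha> s) \<le> R / s" if "s \<ge> 1" for s
  proof (rule Lim_bounded)
    show "(\<lambda>k. norm (tangent c0 \<alpha> (real k) - tangent c0 \<alpha> s)) \<longlonglongrightarrow> norm (A - tangent c0 \<alpha> s)"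
      by (intro tendsto_intros A)
    show "\<forall>k\<ge>nat \<lceil>s\<rceil>. norm (tangent c0 \<alpha> (real k) - tangent c0 \<alpha> s) \<le> R / s"
      using tangent_tail[OF c0 \<alpha> that] unfolding R_def by (meson le_nat_iff nat_ceiling_le_eq)
  qed
  have lim: "(tangent c0 \<alpha> \<longlongrightarrow> A) at_top"
  proof (rule Lim_transform2[OF tendsto_const])
    show "((\<lambda>s. A - tangent c0 \<alpha> s) \<longlongrightarrow> 0) at_top"
      by (rule Lim_null_comparison[OF eventually_mono[OF eventually_ge_at_top[of 1] tail] R_lim])
  qed
  then have A_eq: "A_plus c0 \<alpha> = A"
    unfolding A_plus_def by (intro tendsto_Lim) auto
  show "(tangent c0 \<alpha> \<longlongrightarrow> A_plus c0 \<alpha>) at_top" using lim A_eq by simp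
  show "s \<ge> 1 \<Longrightarrow> norm (A_plus c0 \<alpha> - tangent c0 \<alpha> s) \<le> (6 * c0 + 4 * c0\<^sup>2) / s"
    using tail A_eq by (simp add: R_def)
qed

lemma norm_A_plus:
  assumes "c0 \<ge> 0" "\<alpha> \<in> {0..1}"
  shows "norm (A_plus c0 \<alpha>) = 1"
proof (rule tendsto_unique)
  show "((\<lambda>s. norm (tangent c0 \<alpha> s)) \<longlongrightarrow> norm (A_plus c0 \<alpha>)) at_top"
    by (intro tendsto_norm A_plus_limit assms)
  show "((\<lambda>s. norm (tangent c0 \<alpha> s)) \<longlongrightarrow> 1) at_top" by (simp add: norm_tangent)
qed simp

lemma norm_rate_diff_zero:
  assumes "\<alpha> \<in> {0..1}"
  shows "norm (rate \<alpha> - rate 0) \<le> 2 * \<alpha>"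
proof -
  have "1 - \<alpha> \<le> sqrt (1 - \<alpha>\<^sup>2)"
    using assms by (intro real_le_rsqrt) (simp add: power2_eq_square algebra_simps mult_left_le)
  moreover have "sqrt (1 - \<alpha>\<^sup>2) \<le> 1" by simp
  ultimately show ?thesis
    using cmod_le[of "rate \<alpha> - rate 0"] assms by (simp add: rate_def)
qed

lemma norm_rate_diff_one:
  assumes "\<alpha> \<in> {0..1}"
  shows "norm (rate \<alpha> - rate 1) \<le> 3 * sqrt (1 - \<alpha>)"
proof -
  have "1 - \<alpha> \<le> sqrt (1 - \<alpha>)"
    using assms by (intro real_le_rsqrt) (simp add: power2_eq_square mult_left_le)
  moreover have "sqrt (1 - \<alpha>\<^sup>2) \<le> 2 * sqrt (1 - \<alpha>)"
  proof -
    have "1 - \<alpha>\<^sup>2 \<le> 4 * (1 - \<alpha>)"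
      using assms mult_nonneg_nonneg[of "1 - \<alpha>" "3 - \<alpha>"] by (simp add: power2_eq_square algebra_simps)
    then have "sqrt (1 - \<alpha>\<^sup>2) \<le> sqrt (4 * (1 - \<alpha>))" by (rule real_sqrt_le_mono)
    also have "sqrt (4 * (1 - \<alpha>)) = 2 * sqrt (1 - \<alpha>)" unfolding real_sqrt_mult by simp
    finally show ?thesis .
  qed
  moreover have "sqrt (1 - \<alpha>\<^sup>2) \<ge> 0"
    using assms by (simp add: abs_square_le_1)
  ultimately show ?thesis
    using cmod_le[of "rate \<alpha> - rate 1"] assms by (simp add: rate_def)
qed

text \<open>At a fixed time the tangent is Lipschitz in the rate, and the tangents converge to their limits
  uniformly in the parameter, since the tail bound does not depend on it.\<close>

lemma continuous_on_A_plus: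
  assumes c0: "c0 \<ge> 0"
  shows "continuous_on {0..1} (A_plus c0)"
proof (rule uniform_limit_theorem[where F = at_top and f = "\<lambda>s \<alpha>. tangent c0 \<alpha> s"])
  have "continuous_on {0..1} (\<lambda>\<alpha>. tangent c0 \<alpha> s)" if s: "s \<ge> 0" for s
    unfolding continuous_on_def
  proof
    fix \<alpha> :: real assume \<alpha>: "\<alpha> \<in> {0..1}"
    have le: "norm (tangent c0 \<alpha>' s - tangent c0 \<alpha> s) \<le> c0 * norm (rate \<alpha>' - rate \<alpha>) * (s ^ 3 / 6)"
      if \<alpha>': "\<alpha>' \<in> {0..1}" for \<alpha>'
    proof -
      let ?\<kappa> = "norm (rate \<alpha>' - rate \<alpha>)"
      have "norm (tangent c0 \<alpha>' s - tangent c0 \<alpha> s) \<le> c0 * ?\<kappa> * (s ^ 3 / 6) - c0 * ?\<kappa> * (0 ^ 3 / 6)"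
      proof (rule tangent_comparison[OF s])
        fix t :: real
        show "((\<lambda>t. c0 * ?\<kappa> * (t ^ 3 / 6)) has_real_derivative c0 * ?\<kappa> * (t\<^sup>2 / 2)) (at t)"
          by (auto intro!: derivative_eq_intros)
        show "2 * norm (chirp c0 (rate \<alpha>') t - chirp c0 (rate \<alpha>) t) \<le> c0 * ?\<kappa> * (t\<^sup>2 / 2)"
          using norm_chirp_diff_le[OF c0, of 0 "rate \<alpha>'" "rate \<alpha>" t] \<alpha> \<alpha>' by simp
      qed
      then show ?thesis by simp
    qed
    have "continuous_on {0..1} (\<lambda>\<alpha>'. c0 * norm (rate \<alpha>' - rate \<alpha>) * (s ^ 3 / 6))"
      unfolding rate_def Complex_eq by (intro continuous_intros)
    then have "((\<lambda>\<alpha>'. c0 * norm (rate \<alpha>' - rate \<alpha>) * (s ^ 3 / 6)) \<longlongrightarrow>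
        c0 * norm (rate \<alpha> - rate \<alpha>) * (s ^ 3 / 6)) (at \<alpha> within {0..1})"
      using \<alpha> unfolding continuous_on_def by blast
    then have "((\<lambda>\<alpha>'. c0 * norm (rate \<alpha>' - rate \<alpha>) * (s ^ 3 / 6)) \<longlongrightarrow> 0) (at \<alpha> within {0..1})"
      by simp
    then have "((\<lambda>\<alpha>'. tangent c0 \<alpha>' s - tangent c0 \<alpha> s) \<longlongrightarrow> 0) (at \<alpha> within {0..1})"
      by (rule Lim_null_comparison[rotated]) (use le in \<open>simp add: eventually_at_filter\<close>)
    then show "((\<lambda>\<alpha>'. tangent c0 \<alpha>' s) \<longlongrightarrow> tangent c0 \<alpha> s) (at \<alpha> within {0..1})"
      by (simp add: LIM_zero_iff)
  qed
  then show "\<forall>\<^sub>F s in at_top. continuous_on {0..1} (\<lambda>\<alpha>. tangent c0 \<alpha> s)"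
    by (auto intro: eventually_mono[OF eventually_ge_at_top[of 0]])
  show "uniform_limit {0..1} (\<lambda>s \<alpha>. tangent c0 \<alpha> s) (A_plus c0) at_top"
  proof (rule uniform_limitI)
    fix e :: real assume "e > 0"
    have "((\<lambda>s. (6 * c0 + 4 * c0\<^sup>2) / s) \<longlongrightarrow> 0) at_top"
      by (rule tendsto_divide_0[OF tendsto_const filterlim_at_top_imp_at_infinity[OF filterlim_ident]])
    from order_tendstoD(2)[OF this \<open>e > 0\<close>] eventually_ge_at_top[of 1]
    show "\<forall>\<^sub>F s in at_top. \<forall>\<alpha>\<in>{0..1}. dist (tangent c0 \<alpha> s) (A_plus c0 \<alpha>) < e"
    proof eventually_elim
      case (elim s)
      then show ?case
        using A_plus_tail[OF c0] by (fastforce simp: dist_norm norm_minus_commute)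
    qed
  qed
qed simp

text \<open>For \<open>\<alpha> \<ge> 1/2\<close> the chirps decay at least like \<open>exp (- s\<^sup>2 / 8)\<close>, so their difference is integrable on
  the half line, with an integral proportional to the distance of the rates. The dominating function
  is the derivative of a multiple of \<open>arctan\<close>.\<close>

lemma A_plus_near_one:
  assumes c0: "c0 \<ge> 0" and \<alpha>: "\<alpha> \<in> {1/2..1}"
  shows "norm (A_plus c0 \<alpha> - A_plus c0 1) \<le> 384 * c0 * sqrt (1 - \<alpha>)"
proof -
  define \<kappa> where "\<kappa> = norm (rate \<alpha> - rate 1)"
  have \<alpha>1: "\<alpha> \<in> {0..1}" using \<alpha> by simp
  have "norm (tangent c0 \<alpha> s - tangent c0 1 s) \<le> 128 * c0 * \<kappa>" if s: "s \<ge> 0" for s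
  proof -
    have "norm (tangent c0 \<alpha> s - tangent c0 1 s) \<le> 64 * c0 * \<kappa> * arctan s - 64 * c0 * \<kappa> * arctan 0"
    proof (rule tangent_comparison[OF s])
      fix t :: real
      show "((\<lambda>t. 64 * c0 * \<kappa> * arctan t) has_real_derivative 64 * c0 * \<kappa> * (1 / (1 + t\<^sup>2))) (at t)"
        by (auto intro!: derivative_eq_intros simp: divide_inverse)
      define v where "v = t\<^sup>2 / 8"
      have v: "v \<ge> 0" by (simp add: v_def)
      have t2: "t\<^sup>2 = 8 * v" by (simp add: v_def)
      \<comment> \<open>The quadratic Taylor polynomial of \<open>exp\<close> already dominates the left side.\<close>
      have "2 * v * (1 + 8 * v) \<le> 32 * exp v"
        using exp_lower_Taylor_quadratic[OF v] v by (simp add: algebra_simps power2_eq_square)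
      then have "t\<^sup>2 / 4 * exp (- (1 / 2) * (t\<^sup>2 / 4)) \<le> 32 * (1 / (1 + t\<^sup>2))"
        unfolding t2 using v by (simp add: exp_minus divide_simps mult.commute)
      from mult_left_mono[OF this, of "c0 * \<kappa>"]
      have "c0 * \<kappa> * (t\<^sup>2 / 4) * exp (- (1 / 2) * (t\<^sup>2 / 4)) \<le> c0 * \<kappa> * (32 * (1 / (1 + t\<^sup>2)))"
        using c0 by (simp add: \<kappa>_def mult.assoc)
      moreover have "norm (chirp c0 (rate \<alpha>) t - chirp c0 (rate 1) t) \<le>
          c0 * \<kappa> * (t\<^sup>2 / 4) * exp (- (1 / 2) * (t\<^sup>2 / 4))"
        unfolding \<kappa>_def by (rule norm_chirp_diff_le[OF c0]) (use \<alpha> in auto)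
      ultimately show "2 * norm (chirp c0 (rate \<alpha>) t - chirp c0 (rate 1) t) \<le> 64 * c0 * \<kappa> * (1 / (1 + t\<^sup>2))"
        by simp
    qed
    also have "\<dots> \<le> 64 * c0 * \<kappa> * 2"
    proof -
      have "64 * c0 * \<kappa> * arctan s \<le> 64 * c0 * \<kappa> * 2"
        using c0 arctan_ubound[of s] pi_half_less_two by (intro mult_left_mono) (auto simp: \<kappa>_def)
      then show ?thesis by simp
    qed
    finally show ?thesis by simp
  qed
  then have "norm (A_plus c0 \<alpha> - A_plus c0 1) \<le> 128 * c0 * \<kappa>"
    by (intro tendsto_upperbound[OF tendsto_norm[OF tendsto_diff[OF A_plus_limit A_plus_limit]]])
      (use c0 \<alpha>1 in \<open>auto intro: eventually_mono[OF eventually_ge_at_top[of 0]]\<close>)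
  also have "\<dots> \<le> 128 * c0 * (3 * sqrt (1 - \<alpha>))"
    unfolding \<kappa>_def using c0 by (intro mult_left_mono norm_rate_diff_one \<alpha>1) simp
  finally show ?thesis by simp
qed

text \<open>The vector \<open>a = A_plus c0 0\<close> is paired, in the frame of the parameter \<open>0\<close>, with an arbitrary \<open>u\<close> in
  the frame of \<open>\<alpha>\<close>. At time \<open>0\<close> the product is \<open>a \<bullet> u\<close>. Since \<open>a\<close> is the limit of its own tangent, its
  normal coordinates decay like \<open>1 / s\<close>, and at time \<open>S\<close> the product is \<open>u \<bullet> A_plus c0 \<alpha>\<close> up to an error
  of order \<open>1 / S\<close>. In between the product drifts by at most a multiple of \<open>\<alpha> S\<close>. The choice
  \<open>S = 1 / sqrt \<alpha>\<close> balances the two errors.\<close>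

lemma A_plus_near_zero:
  assumes c0: "c0 \<ge> 0"
  obtains C where "C \<ge> 0" "\<And>\<alpha>. \<alpha> \<in> {0<..1} \<Longrightarrow> norm (A_plus c0 \<alpha> - A_plus c0 0) \<le> C * sqrt \<alpha>"
proof
  define R where "R = 6 * c0 + 4 * c0\<^sup>2"
  define K where "K = 25 * c0 + 4 * c0\<^sup>2 + 8 * c0\<^sup>2 * R"
  define a where "a = A_plus c0 0"
  have a: "norm a = 1" using norm_A_plus[OF c0] by (simp add: a_def)
  have R: "R \<ge> 0" and K: "K \<ge> 0" using c0 by (simp_all add: R_def K_def)
  show "2 * K + 3 * R \<ge> 0" using R K by simp
  have a_tail: "norm (a - tangent c0 0 s) \<le> R / s" if "s \<ge> 1" for s
    using A_plus_tail[OF c0 _ that, of 0] by (simp add: a_def R_def)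
  have decay: "norm (normal_coord c0 0 a s) \<le> R / s" if "s \<ge> 1" for s
  proof (rule power2_le_imp_le)
    let ?p = "a \<bullet> tangent c0 0 s"
    have "(norm (normal_coord c0 0 a s))\<^sup>2 = 1 - ?p\<^sup>2"
      using coordinates_norm[of a c0 0 s] a by simp
    also have "\<dots> = 2 - 2 * ?p - (1 - ?p)\<^sup>2" by (simp add: power2_eq_square algebra_simps)
    also have "\<dots> \<le> 2 - 2 * ?p" by simp
    also have "\<dots> = (norm (a - tangent c0 0 s))\<^sup>2"
    proof -
      have "a \<bullet> a = 1" "tangent c0 0 s \<bullet> tangent c0 0 s = 1"
        using a by (simp_all add: norm_tangent flip: power2_norm_eq_inner)
      then show ?thesis
        by (simp add: power2_norm_eq_inner inner_diff_left inner_diff_right inner_commute)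
    qed
    also have "\<dots> \<le> (R / s)\<^sup>2" by (intro power_mono a_tail that) simp
    finally show "(norm (normal_coord c0 0 a s))\<^sup>2 \<le> (R / s)\<^sup>2" .
    show "R / s \<ge> 0" using R that by simp
  qed
  fix \<alpha> :: real assume \<alpha>: "\<alpha> \<in> {0<..1}"
  then have \<alpha>1: "\<alpha> \<in> {0..1}" by simp
  define S where "S = 1 / sqrt \<alpha>"
  have S: "S \<ge> 1" using \<alpha> by (simp add: S_def)
  have RS: "R / S = R * sqrt \<alpha>" by (simp add: S_def)
  show "norm (A_plus c0 \<alpha> - A_plus c0 0) \<le> (2 * K + 3 * R) * sqrt \<alpha>"
  proof (rule norm_le_by_duality)
    fix u :: "real^3" assume u: "norm u \<le> 1"
    let ?p = "\<lambda>s. a \<bullet> tangent c0 0 s" and ?r = "normal_coord c0 0 a"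
    let ?x = "\<lambda>s. u \<bullet> tangent c0 \<alpha> s" and ?z = "normal_coord c0 \<alpha> u"
    have a1: "norm a \<le> 1" using a by simp
    have "\<bar>(?p S * ?x S + ?r S \<bullet> ?z S) - (?p 0 * ?x 0 + ?r 0 \<bullet> ?z 0)\<bar>
        \<le> (25 * c0 + 4 * c0\<^sup>2 + 8 * c0\<^sup>2 * R) * norm (rate \<alpha> - rate 0) * S"
      by (rule pairing_drift[OF coordinates_rotate coordinates_rotate
            coordinates_le[OF a1] coordinates_le[OF u] decay c0])
        (use S \<alpha> norm_rate[OF \<alpha>1] norm_rate[of 0] in auto)
    also have "\<dots> \<le> K * (2 * \<alpha>) * S"
      unfolding K_def[symmetric] using K S norm_rate_diff_zero[OF \<alpha>1]
      by (intro mult_right_mono mult_left_mono) auto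
    also have "\<dots> = 2 * K * (\<alpha> / sqrt \<alpha>)" by (simp add: S_def)
    also have "\<alpha> / sqrt \<alpha> = sqrt \<alpha>" using \<alpha> by (simp add: real_div_sqrt)
    finally have drift: "\<bar>(?p S * ?x S + ?r S \<bullet> ?z S) - a \<bullet> u\<bar> \<le> 2 * K * sqrt \<alpha>"
      unfolding coordinates_initial_pairing .
    have "1 - ?p S = a \<bullet> (a - tangent c0 0 S)"
      using a by (simp add: inner_diff_right flip: power2_norm_eq_inner)
    then have "\<bar>1 - ?p S\<bar> \<le> 1 * (R / S)"
      using abs_inner_le[OF a1 a_tail[OF S]] by simp
    from abs_mult_le[OF this coordinates_le(1)[OF u]]
    have 1: "\<bar>(1 - ?p S) * ?x S\<bar> \<le> R * sqrt \<alpha>" by (simp add: RS)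
    have 2: "\<bar>?r S \<bullet> ?z S\<bar> \<le> R * sqrt \<alpha>"
      using abs_inner_le[OF decay[OF S] coordinates_le(2)[OF u]] by (simp add: RS)
    have 3: "\<bar>u \<bullet> A_plus c0 \<alpha> - ?x S\<bar> \<le> R * sqrt \<alpha>"
      using abs_inner_le[OF u A_plus_tail[OF c0 \<alpha>1 S]] RS by (simp add: R_def inner_diff_right)
    have "u \<bullet> (A_plus c0 \<alpha> - A_plus c0 0) = (u \<bullet> A_plus c0 \<alpha> - ?x S) + (1 - ?p S) * ?x S
        - ?r S \<bullet> ?z S + ((?p S * ?x S + ?r S \<bullet> ?z S) - a \<bullet> u)"
      by (simp add: a_def inner_diff_right inner_commute algebra_simps)
    then have "\<bar>u \<bullet> (A_plus c0 \<alpha> - A_plus c0 0)\<bar> \<le> 2 * K * sqrt \<alpha> + 3 * (R * sqrt \<alpha>)"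
      using 1 2 3 drift by linarith
    then show "\<bar>u \<bullet> (A_plus c0 \<alpha> - A_plus c0 0)\<bar> \<le> (2 * K + 3 * R) * sqrt \<alpha>"
      by (simp add: algebra_simps)
  qed
qed

theorem theorem1p4:
  fixes c0 :: real
  assumes "c0 > 0"
  shows "continuous_on {0..1} (A_plus c0) \<and>
    (\<exists>C>0.
      (\<forall>\<alpha>\<in>{0<..1/2}. norm (A_plus c0 \<alpha> - A_plus c0 0) \<le> C * sqrt \<alpha> * \<bar>ln \<alpha>\<bar>) \<and>
      (\<forall>\<alpha>\<in>{1/2..1}. norm (A_plus c0 \<alpha> - A_plus c0 1) \<le> C * sqrt (1 - \<alpha>)))"
proof
  have c0: "c0 \<ge> 0" using assms by simp
  show "continuous_on {0..1} (A_plus c0)" by (rule continuous_on_A_plus[OF c0])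
  obtain K where K: "K \<ge> 0"
    and near0: "\<And>\<alpha>. \<alpha> \<in> {0<..1} \<Longrightarrow> norm (A_plus c0 \<alpha> - A_plus c0 0) \<le> K * sqrt \<alpha>"
    using A_plus_near_zero[OF c0] by blast
  let ?C = "2 * K + 384 * c0"
  have "norm (A_plus c0 \<alpha> - A_plus c0 0) \<le> ?C * sqrt \<alpha> * \<bar>ln \<alpha>\<bar>" if \<alpha>: "\<alpha> \<in> {0<..1/2}" for \<alpha>
  proof -
    have "ln \<alpha> \<le> \<alpha> - 1" using \<alpha> by (intro ln_le_minus_one) simp
    then have ln: "1 / 2 \<le> \<bar>ln \<alpha>\<bar>" using \<alpha> by simp
    have "norm (A_plus c0 \<alpha> - A_plus c0 0) \<le> 2 * K * sqrt \<alpha> * (1 / 2)"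
      using near0[of \<alpha>] \<alpha> by simp
    also have "\<dots> \<le> ?C * sqrt \<alpha> * \<bar>ln \<alpha>\<bar>"
      using K c0 \<alpha> ln by (intro mult_mono) auto
    finally show ?thesis .
  qed
  moreover have "norm (A_plus c0 \<alpha> - A_plus c0 1) \<le> ?C * sqrt (1 - \<alpha>)" if \<alpha>: "\<alpha> \<in> {1/2..1}" for \<alpha>
  proof -
    have "384 * c0 * sqrt (1 - \<alpha>) \<le> ?C * sqrt (1 - \<alpha>)"
      using K \<alpha> by (intro mult_right_mono) auto
    then show ?thesis using A_plus_near_one[OF c0 \<alpha>] by linarith
  qed
  moreover have "?C > 0" using K assms by simp
  ultimately show "\<exists>C>0.
      (\<forall>\<alpha>\<in>{0<..1/2}. norm (A_plus c0 \<alpha> - A_plus c0 0) \<le> C * sqrt \<alpha> * \<bar>ln \<alpha>\<bar>) \<and>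
      (\<forall>\<alpha>\<in>{1/2..1}. norm (A_plus c0 \<alpha> - A_plus c0 1) \<le> C * sqrt (1 - \<alpha>))"
    by blast
qed

end
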